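(* Let $r\in\{3,4,\ldots\}$ and let either $k=r-2$ or $k=r-1$. Then, for every $f\in L_2^r$, there holds the inequality \[ \left\|f^{(k)}\right\|_\infty\leqslant\left\|u_0^{(r)}\right\|_2\|f\|_2+\left\|u_0\right\|_2\left\|f^{(r)}\right\|_2, \] and this inequality is sharp, i.e. for the coefficient $A=\|u_0^{(r)}\|_2$ of $\|f\|_2$ the constant $B=\|u_0\|_2$ is the smallest possible: \[ \left\|u_0\right\|_2=\sup\left\{\left\|f^{(k)}\right\|_\infty-\left\|u_0^{(r)}\right\|_2\|f\|_2:\ f\in L_2^r,\ \|f^{(r)}\|_2\leqslant1\right\}. \]
   Context: Let $\mathbb{I}=[-1,1]$, $L_2=L_2(\mathbb{I})$ (real-valued functions) with norm $\|f\|_2=\left(\int_{-1}^1|f(x)|^2\,dx\right)^{1/2}$, and $\|f\|_\infty=\operatorname{ess\,sup}_{x\in\mathbb{I}}|f(x)|$. $L_2^r$ is the space of functions $f:\mathbb{I}\to\mathbb{R}$ having absolutely continuous derivative $f^{(r-1)}$ and such that $f^{(r)}\in L_2$. $u_0$ (depending on $r$ and $k$) is the unique solution of $u^{(2r)}=0$ on $(-1,1)$, i.e. the unique real polynomial of degree at most $2r-1$, satisfying \[ u_0^{(s)}(-1)=(-1)^{k-1}\delta_{r-k-1,s},\qquad u_0^{(s)}(1)=0,\qquad s=0,1,\ldots,r-1, \] where $\delta_{i,j}$ is the Kronecker symbol. *)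

theory Defs
  imports
    "HOL-Probability.Essential_Supremum"
    "HOL-Computational_Algebra.Polynomial"
begin

abbreviation II :: "real set" where
  "II \<equiv> {-1..1}"

text \<open>The derivative of order \<open>j\<close> of a function on \<open>[-1,1]\<close>. Derivatives are taken relative to
  \<open>[-1,1]\<close>, hence one-sided at the end points, and depend only on the values of the function on
  \<open>[-1,1]\<close>; at points without a derivative the value is immaterial.\<close>

definition derivI :: "nat \<Rightarrow> (real \<Rightarrow> real) \<Rightarrow> real \<Rightarrow> real" where
  "derivI j f = ((\<lambda>g x. vector_derivative g (at x within II)) ^^ j) f"

definition abs_continuous_on_Icc :: "real \<Rightarrow> real \<Rightarrow> (real \<Rightarrow> real) \<Rightarrow> bool" where
  "abs_continuous_on_Icc c d g \<longleftrightarrow>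
     (\<forall>\<epsilon>>0. \<exists>\<delta>>0. \<forall>(n::nat) (a::nat \<Rightarrow> real) (b::nat \<Rightarrow> real).
        (\<forall>i<n. c \<le> a i \<and> a i \<le> b i \<and> b i \<le> d) \<and>
        (\<forall>i<n. \<forall>j<n. i \<noteq> j \<longrightarrow> {a i<..<b i} \<inter> {a j<..<b j} = {}) \<and>
        (\<Sum>i<n. b i - a i) < \<delta>
        \<longrightarrow> (\<Sum>i<n. \<bar>g (b i) - g (a i)\<bar>) < \<epsilon>)"

definition L2 :: "(real \<Rightarrow> real) set" where
  "L2 = {f \<in> borel_measurable (lebesgue_on II). integrable (lebesgue_on II) (\<lambda>x. \<bar>f x\<bar>\<^sup>2)}"

definition norm2 :: "(real \<Rightarrow> real) \<Rightarrow> real" where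
  "norm2 f = sqrt (LINT x|lebesgue_on II. \<bar>f x\<bar>\<^sup>2)"

definition norm_inf :: "(real \<Rightarrow> real) \<Rightarrow> ereal" where
  "norm_inf f = esssup (lebesgue_on II) (\<lambda>x. ereal \<bar>f x\<bar>)"

text \<open>For \<open>r \<ge> 1\<close>. Absolute continuity of the derivative of order \<open>r - 1\<close> makes the derivative
  of order \<open>r\<close> exist almost everywhere.\<close>

definition L2r :: "nat \<Rightarrow> (real \<Rightarrow> real) set" where
  "L2r r = {f. (\<forall>j<r - 1. derivI j f differentiable_on II) \<and>
               abs_continuous_on_Icc (-1) 1 (derivI (r - 1) f) \<and>
               derivI r f \<in> L2}"

definition u0_conditions :: "nat \<Rightarrow> nat \<Rightarrow> real poly \<Rightarrow> bool" where
  "u0_conditions r k p \<longleftrightarrow>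
     degree p \<le> 2 * r - 1 \<and>
     (\<forall>s<r. poly ((pderiv ^^ s) p) (-1) = (-1) ^ (k - 1) * (if r - k - 1 = s then 1 else 0) \<and>
            poly ((pderiv ^^ s) p) 1 = 0)"

definition u0 :: "nat \<Rightarrow> nat \<Rightarrow> real poly" where
  "u0 r k = (THE p. u0_conditions r k p)"

lemma higher_pderiv_zero_iff_dvd:
  fixes p :: "real poly"
  shows "(\<forall>s<n. poly ((pderiv ^^ s) p) a = 0) \<longleftrightarrow> [:- a, 1:] ^ n dvd p"
proof (induction n arbitrary: p)
  case 0
  show ?case by simp
next
  case (Suc n)
  have split: "(\<forall>s<Suc n. poly ((pderiv ^^ s) p) a = 0) \<longleftrightarrow>
      poly p a = 0 \<and> (\<forall>s<n. poly ((pderiv ^^ s) (pderiv p)) a = 0)"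
    unfolding All_less_Suc2 by (simp add: funpow_swap1)
  show ?case
  proof (cases "poly p a = 0 \<and> p \<noteq> 0")
    case True
    then have ord: "order a p = Suc (order a (pderiv p))"
      by (intro order_pderiv) (auto simp: order_root)
    have "pderiv p \<noteq> 0"
    proof
      assume "pderiv p = 0"
      then obtain c where "p = [:c:]"
        by (meson degree_eq_zeroE pderiv_eq_0_iff)
      with True show False by auto
    qed
    with True ord show ?thesis
      unfolding split Suc.IH by (simp add: order_divides del: power_Suc)
  next
    case False
    have "\<not> [:- a, 1:] ^ Suc n dvd p" if "poly p a \<noteq> 0"
      using that by (metis dvd_power dvd_trans poly_eq_0_iff_dvd zero_less_Suc)
    moreover have "(pderiv ^^ s) 0 = (0 :: real poly)" for s
      by (induction s) auto
    ultimately show ?thesis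
      using False by auto
  qed
qed

lemma higher_pderiv_add:
  "(pderiv ^^ s) (p + q :: real poly) = (pderiv ^^ s) p + (pderiv ^^ s) q"
  by (induction s) (auto simp: pderiv_add)

lemma higher_pderiv_smult:
  "(pderiv ^^ s) (smult c p :: real poly) = smult c ((pderiv ^^ s) p)"
  by (induction s) (auto simp: pderiv_smult)

lemma higher_pderiv_power_at:
  fixes a :: real
  shows "poly ((pderiv ^^ s) ([:- a, 1:] ^ n)) a = (if n = s then fact n else 0)"
proof (induction s arbitrary: n)
  case 0
  show ?case by (simp add: poly_power)
next
  case (Suc s)
  show ?case
  proof (cases n)
    case 0
    have "(pderiv ^^ j) 0 = (0 :: real poly)" for j
      by (induction j) auto
    with 0 show ?thesis by (simp add: funpow_swap1)
  next
    case (Suc m)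
    have "pderiv ([:- a, 1:] ^ Suc m) = smult (real (Suc m)) ([:- a, 1:] ^ m)"
      by (simp only: pderiv_power_Suc) (simp add: pderiv_pCons)
    then show ?thesis
      using Suc.IH[of m] Suc by (simp add: funpow_swap1 higher_pderiv_smult del: power_Suc)
  qed
qed

lemma bezout_powers:
  fixes x y :: "'a::comm_ring_1"
  assumes "a * x + b * y = 1"
  shows "\<exists>c d. c * x ^ m + d * y ^ n = 1"
proof -
  have step: "\<exists>c d. c * x ^ m + d * y = 1" if "a * x + b * y = 1" for a b x y :: 'a and m
  proof (induction m)
    case 0
    have "1 * x ^ 0 + 0 * y = 1" by simp
    then show ?case by blast
  next
    case (Suc m)
    then obtain c d where cd: "c * x ^ m + d * y = 1" by blast
    have "1 = (a * x + b * y) * (c * x ^ m + d * y)"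
      using that cd by simp
    also have "\<dots> = (a * c) * x ^ Suc m + (a * x * d + b * (c * x ^ m + d * y)) * y"
      by (simp add: algebra_simps)
    finally show ?case by metis
  qed
  obtain c d where "c * x ^ m + d * y = 1"
    using step[OF assms] by blast
  then have "d * y + c * x ^ m = 1"
    by (simp add: add.commute)
  from step[OF this, of n] show ?thesis
    by (metis add.commute)
qed

lemma u0_conditions_ex1:
  assumes "r \<ge> 1"
  shows "\<exists>!p. u0_conditions r k p"
proof -
  define P Q :: "real poly" where "P = [:- (-1), 1:] ^ r" and "Q = [:- 1, 1:] ^ r"
  have "[:1/2:] * [:- (-1), 1:] + [:-1/2:] * [:- 1, 1:] = (1 :: real poly)"
    by (simp add: one_pCons)
  then obtain a b where ab: "a * P + b * Q = 1"
    unfolding P_def Q_def using bezout_powers by blast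
  have PQ0: "P * Q \<noteq> 0" and degPQ: "degree (P * Q) = 2 * r"
    by (auto simp: P_def Q_def degree_mult_eq degree_power_eq)
  define c :: real where "c = (-1) ^ (k - 1) / fact (r - k - 1)"
  define p0 where "p0 = smult c ([:- (-1), 1:] ^ (r - k - 1))"
  have p0: "poly ((pderiv ^^ s) p0) (-1) = (-1) ^ (k - 1) * (if r - k - 1 = s then 1 else 0)" for s
    unfolding p0_def higher_pderiv_smult poly_smult higher_pderiv_power_at by (simp add: c_def)
  have char: "u0_conditions r k p \<longleftrightarrow> degree p \<le> 2 * r - 1 \<and> P dvd (p - p0) \<and> Q dvd p" for p
  proof -
    have "poly ((pderiv ^^ s) p) (-1) =
        poly ((pderiv ^^ s) (p - p0)) (-1) + poly ((pderiv ^^ s) p0) (-1)" for s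
      using higher_pderiv_add[of s "p - p0" p0] by simp
    then show ?thesis
      unfolding u0_conditions_def P_def Q_def higher_pderiv_zero_iff_dvd[symmetric] p0 by auto
  qed
  define p where "p = (p0 * b * Q) mod (P * Q)"
  have "degree p < 2 * r"
    using degree_mod_less'[OF PQ0, of "p0 * b * Q"] degPQ assms
    unfolding p_def[symmetric] by (cases "p = 0") auto
  moreover have Qp: "Q dvd p"
    unfolding p_def by (simp add: dvd_mod)
  moreover have "P dvd p - p0"
  proof -
    have "p0 = p0 * (a * P + b * Q)"
      using ab by simp
    then have "p - p0 = - (P * Q * ((p0 * b * Q) div (P * Q))) - p0 * a * P"
      unfolding p_def minus_div_mult_eq_mod[symmetric] by (simp add: algebra_simps)
    then show ?thesis by simp
  qed
  ultimately have ex: "u0_conditions r k p"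
    by (simp add: char)
  moreover have "q = p" if "u0_conditions r k q" for q
  proof (rule ccontr)
    assume "q \<noteq> p"
    have "P dvd (q - p0) - (p - p0)" "Q dvd q - p"
      using that ex unfolding char by (blast intro: dvd_diff)+
    then have "P * Q dvd q - p"
    proof -
      have "P * Q dvd (q - p) * (a * P + b * Q)"
        unfolding distrib_left
        using \<open>P dvd (q - p0) - (p - p0)\<close> \<open>Q dvd q - p\<close>
        by (intro dvd_add) (auto simp: mult.commute mult.left_commute intro!: mult_dvd_mono dvd_mult)
      then show ?thesis using ab by simp
    qed
    then have "2 * r \<le> degree (q - p)"
      using \<open>q \<noteq> p\<close> dvd_imp_degree_le degPQ by fastforce
    moreover have "degree (q - p) \<le> 2 * r - 1"
      using that ex unfolding char by (blast intro: degree_diff_le)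
    ultimately show False using assms by linarith
  qed
  ultimately show ?thesis by blast
qed

end

theory Submission
  imports Defs
begin

text \<open>Fix \<open>x\<close> in \<open>[-1,1]\<close> and glue a polynomial vanishing to order \<open>r\<close> at \<open>-1\<close> (used to the left of
  \<open>x\<close>) to one vanishing to order \<open>r\<close> at \<open>1\<close> (used to the right), such that their difference is
  \<open>(t - x)^(r-k-1)\<close> up to sign. Integrating the glued kernel \<open>g\<^sub>x\<close> against \<open>f^(r)\<close> by parts
  expresses \<open>f^(k)(x)\<close> through \<open>\<integral> g\<^sub>x f^(r)\<close> and \<open>\<integral> g\<^sub>x^(r) f\<close>, and the Cauchy-Schwarz inequality
  gives the estimate with constants \<open>\<parallel>g\<^sub>x^(r)\<parallel>\<close> and \<open>\<parallel>g\<^sub>x\<parallel>\<close>. For \<open>x = -1\<close> the kernel is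
  \<open>u\<^sub>0\<close> up to sign, so it remains to see that both norms are largest at the end points. For
  \<open>k = r - 1\<close> this is a pointwise comparison. For \<open>k = r - 2\<close> the first norm is handled by
  parity, and \<open>N(x) = \<parallel>g\<^sub>x\<parallel>\<^sup>2\<close> is even with nonnegative third derivative on \<open>[0,1]\<close>. So \<open>N'\<close> is
  convex there with \<open>N'(0) = 0\<close>, which gives \<open>N \<le> max (N 0) (N 1)\<close>, and \<open>N 0 \<le> N 1\<close> is checked
  directly.

  For sharpness take \<open>f = \<Phi> + c u\<^sub>0^(r)\<close> with \<open>\<Phi>^(r) = \<plusminus> u\<^sub>0 / \<parallel>u\<^sub>0\<parallel>\<close> and \<open>\<Phi>\<close> orthogonal to
  \<open>u\<^sub>0^(r)\<close>, and let \<open>c\<close> tend to infinity; adding \<open>c u\<^sub>0^(r)\<close> does not change \<open>f^(r)\<close> because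
  \<open>u\<^sub>0\<close> has degree below \<open>2r\<close>.\<close>

section \<open>Differentiation of functions of bounded variation\<close>

text \<open>The definition speaks of families indexed by \<open>{..<n}\<close>. Carrying it over
  along an enumeration of a finite set allows families indexed by the cells of a division or by
  tagged intervals.\<close>

lemma abs_continuous_finite_family:
  assumes "abs_continuous_on_Icc c d g" and "\<epsilon> > 0"
  obtains \<delta> where "\<delta> > 0"
    and "\<forall>(I :: 'i set) s t. finite I \<longrightarrow> (\<forall>i\<in>I. c \<le> s i \<and> s i \<le> t i \<and> t i \<le> d) \<longrightarrow>
      (\<forall>i\<in>I. \<forall>j\<in>I. i \<noteq> j \<longrightarrow> {s i<..<t i} \<inter> {s j<..<t j} = {}) \<longrightarrow>
      (\<Sum>i\<in>I. t i - s i) < \<delta> \<longrightarrow> (\<Sum>i\<in>I. \<bar>g (t i) - g (s i)\<bar>) < \<epsilon>"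
proof -
  obtain \<delta> where "\<delta> > 0" and \<delta>: "\<And>(n::nat) (a::nat \<Rightarrow> real) (b::nat \<Rightarrow> real).
        (\<forall>i<n. c \<le> a i \<and> a i \<le> b i \<and> b i \<le> d) \<Longrightarrow>
        (\<forall>i<n. \<forall>j<n. i \<noteq> j \<longrightarrow> {a i<..<b i} \<inter> {a j<..<b j} = {}) \<Longrightarrow>
        (\<Sum>i<n. b i - a i) < \<delta> \<Longrightarrow> (\<Sum>i<n. \<bar>g (b i) - g (a i)\<bar>) < \<epsilon>"
    using assms(1)[unfolded abs_continuous_on_Icc_def, rule_format, OF assms(2)] by blast
  have "(\<Sum>i\<in>I. \<bar>g (t i) - g (s i)\<bar>) < \<epsilon>"
    if I: "finite I" "\<And>i. i \<in> I \<Longrightarrow> c \<le> s i \<and> s i \<le> t i \<and> t i \<le> d"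
      "\<And>i j. i \<in> I \<Longrightarrow> j \<in> I \<Longrightarrow> i \<noteq> j \<Longrightarrow> {s i<..<t i} \<inter> {s j<..<t j} = {}"
      "(\<Sum>i\<in>I. t i - s i) < \<delta>" for I :: "'i set" and s t
  proof -
    obtain h where h: "bij_betw h {..<card I} I"
      using ex_bij_betw_nat_finite[OF I(1)] by (auto simp: atLeast0LessThan)
    have hI: "h i \<in> I" if "i < card I" for i
      using h that by (auto simp: bij_betw_def)
    have hinj: "h i \<noteq> h j" if "i < card I" "j < card I" "i \<noteq> j" for i j
      using h that by (auto simp: bij_betw_def inj_on_def)
    have "(\<Sum>i<card I. \<bar>g (t (h i)) - g (s (h i))\<bar>) < \<epsilon>"
    proof (rule \<delta>)
      show "(\<Sum>i<card I. t (h i) - s (h i)) < \<delta>"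
        using I(4) sum.reindex_bij_betw[OF h, of "\<lambda>i. t i - s i"] by simp
    qed (use I(2,3) hI hinj in auto)
    then show ?thesis
      using sum.reindex_bij_betw[OF h, of "\<lambda>i. \<bar>g (t i) - g (s i)\<bar>"] by simp
  qed
  with \<open>\<delta> > 0\<close> show thesis
    by (intro that[of \<delta>]) auto
qed

text \<open>Arbitrarily short \<open>G\<close>-intervals contain every point of \<open>S\<close>, so
  the Vitali covering theorem picks countably many disjoint ones that cover \<open>S\<close> up to a
  null set. The bound on finite disjoint families passes to their union.\<close>

lemma Vitali_outer_bound:
  fixes S :: "real set"
  assumes cov: "\<And>x d. x \<in> S \<Longrightarrow> 0 < d \<Longrightarrow> \<exists>s t. G s t \<and> s < t \<and> x \<in> {s..t} \<and> t - s < d"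
    and bound: "\<And>F. finite F \<Longrightarrow> (\<And>s t. (s, t) \<in> F \<Longrightarrow> G s t \<and> s < t) \<Longrightarrow>
      pairwise (\<lambda>p q. disjnt {fst p..snd p} {fst q..snd q}) F \<Longrightarrow> (\<Sum>(s,t)\<in>F. t - s) \<le> \<beta>"
  shows "\<exists>T. S \<subseteq> T \<and> T \<in> lmeasurable \<and> measure lebesgue T \<le> \<beta>"
proof -
  define K where "K = {(s,t). G s t \<and> s < t}"
  \<comment> \<open>The covering theorem is stated for closed balls, so an interval is recorded by
    its midpoint \<open>m\<close> and half-length \<open>\<rho>\<close>.\<close>
  define m where "m = (\<lambda>p::real\<times>real. (fst p + snd p) / 2)"
  define \<rho> where "\<rho> = (\<lambda>p::real\<times>real. (snd p - fst p) / 2)"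
  have cb: "cball (m p) (\<rho> p) = {fst p..snd p}" for p
    by (auto simp: cball_def dist_real_def m_def \<rho>_def abs_le_iff field_simps)
  obtain C where C: "countable C" "C \<subseteq> K"
    and pw: "pairwise (\<lambda>i j. disjnt (cball (m i) (\<rho> i)) (cball (m j) (\<rho> j))) C"
    and neg: "negligible (S - (\<Union>i \<in> C. cball (m i) (\<rho> i)))"
  proof (rule Vitali_covering_theorem_cballs[of K \<rho> S m])
    show "0 < \<rho> i" if "i \<in> K" for i
      using that by (auto simp: K_def \<rho>_def)
    show "\<exists>i. i \<in> K \<and> x \<in> cball (m i) (\<rho> i) \<and> \<rho> i < d" if "x \<in> S" "0 < d" for x d
    proof -
      obtain s t where "G s t" "s < t" "x \<in> {s..t}" "t - s < d"
        using cov \<open>x \<in> S\<close> \<open>0 < d\<close> by blast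
      then show ?thesis
        by (intro exI[of _ "(s,t)"]) (auto simp: K_def cb, simp add: \<rho>_def)
    qed
  qed (rule that)
  have le: "measure lebesgue (\<Union>i\<in>J. {fst i..snd i}) \<le> \<beta>" if "J \<subseteq> C" "finite J" for J
  proof -
    have "measure lebesgue (\<Union>i\<in>J. {fst i..snd i}) \<le> (\<Sum>i\<in>J. measure lebesgue {fst i..snd i})"
      using that by (intro measure_UNION_le) auto
    also have "\<dots> = (\<Sum>i\<in>J. snd i - fst i)"
      using that C(2) by (intro sum.cong) (auto simp: K_def)
    also have "\<dots> \<le> \<beta>"
    proof -
      have "(s, t) \<in> J \<Longrightarrow> G s t \<and> s < t" for s t
        using that(1) C(2) by (auto simp: K_def)
      from bound[OF \<open>finite J\<close> this pairwise_subset[OF pw that(1), unfolded cb]]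
      show ?thesis by (simp add: case_prod_unfold)
    qed
    finally show ?thesis .
  qed
  let ?U = "\<Union>i\<in>C. {fst i..snd i}"
  have U: "?U \<in> lmeasurable" "measure lebesgue ?U \<le> \<beta>"
    using le C(1) by (auto intro!: fmeasurable_UN_bound[OF C(1)] measure_UN_bound[OF C(1)])
  have neg': "negligible (S - ?U)"
    using neg unfolding cb .
  have T: "?U \<union> (S - ?U) \<in> lmeasurable"
    using U(1) negligible_imp_measurable[OF neg'] by (rule fmeasurable.Un)
  have "measure lebesgue (?U \<union> (S - ?U)) \<le> measure lebesgue ?U + measure lebesgue (S - ?U)"
    using U(1) negligible_imp_measurable[OF neg'] by (intro measure_Un_le) auto
  also have "\<dots> \<le> \<beta>"
    using U(2) negligible_imp_measure0[OF neg'] by simp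
  finally show ?thesis
    using T by (intro exI[of _ "?U \<union> (S - ?U)"]) blast
qed

section \<open>Variation over divisions of an interval\<close>

text \<open>\<open>Inf K\<close> and \<open>Sup K\<close> are the end points of a cell. Divisions
  may contain degenerate cells; these contribute zero.\<close>

definition variation :: "(real \<Rightarrow> real) \<Rightarrow> real set set \<Rightarrow> real" where
  "variation g D = (\<Sum>K\<in>D. \<bar>g (Sup K) - g (Inf K)\<bar>)"

definition bounded_variation_Icc :: "real \<Rightarrow> real \<Rightarrow> (real \<Rightarrow> real) \<Rightarrow> bool" where
  "bounded_variation_Icc u v g \<longleftrightarrow> (\<exists>B. \<forall>D. D division_of {u..v} \<longrightarrow> variation g D \<le> B)"

lemma division_interval_real:
  assumes "D division_of S" "K \<in> D"
  shows "K = {Inf K..Sup K}" "Inf K \<le> Sup (K :: real set)" "K \<subseteq> S"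
proof -
  obtain a b where ab: "K = cbox a b"
    using division_ofD(4)[OF assms] by auto
  moreover have "K \<noteq> {}" "K \<subseteq> S"
    using division_ofD(2,3)[OF assms] by auto
  ultimately show "K = {Inf K..Sup K}" "Inf K \<le> Sup (K :: real set)" "K \<subseteq> S" by auto
qed

text \<open>Tagging every cell with its left end point turns the division into a tagged division,
  for which the telescoping identity is known.\<close>

lemma sum_division_telescope:
  fixes g :: "real \<Rightarrow> real"
  assumes "D division_of {u..v}" "u \<le> v"
  shows "(\<Sum>K\<in>D. g (Sup K) - g (Inf K)) = g v - g u"
proof -
  have fin: "finite D" using assms(1) by auto
  have inj: "inj_on (\<lambda>K. (Inf K, K)) D" by (auto simp: inj_on_def)
  have "(\<lambda>K. (Inf K, K)) ` D tagged_division_of {u..v}"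
  proof (rule tagged_division_ofI)
    show "\<Union> {K. \<exists>x. (x, K) \<in> (\<lambda>K. (Inf K, K)) ` D} = {u..v}"
      unfolding division_ofD(6)[OF assms(1), symmetric] by blast
    show "x \<in> K" if "(x, K) \<in> (\<lambda>K. (Inf K, K)) ` D" for x K
    proof -
      have "x = Inf K" "K \<in> D" using that by auto
      then show ?thesis
        using division_interval_real[OF assms(1)] by (metis atLeastAtMost_iff order_refl)
    qed
    show "interior K1 \<inter> interior K2 = {}" if "(x1, K1) \<in> (\<lambda>K. (Inf K, K)) ` D"
      "(x2, K2) \<in> (\<lambda>K. (Inf K, K)) ` D" "(x1, K1) \<noteq> (x2, K2)" for x1 K1 x2 K2
    proof -
      have "K1 \<in> D" "K2 \<in> D" "K1 \<noteq> K2" using that by auto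
      then show ?thesis by (rule division_ofD(5)[OF assms(1)])
    qed
    show "K \<subseteq> {u..v}" "\<exists>a b. K = cbox a b" if "(x, K) \<in> (\<lambda>K. (Inf K, K)) ` D" for x K
      using that division_ofD(2,4)[OF assms(1), of K] by auto
  qed (use fin in simp)
  from additive_tagged_division_1[OF assms(2) this, of g] show ?thesis
    by (simp add: sum.reindex[OF inj])
qed

lemma division_refine_Union:
  fixes D :: "real set set"
  assumes D: "D division_of S" and E: "\<And>K. K \<in> D \<Longrightarrow> E K division_of K"
  shows "(\<Union>K\<in>D. E K) division_of S"
    and "(\<Sum>K\<in>D. variation g (E K)) = variation g (\<Union>K\<in>D. E K)"
proof -
  have ints: "interior J \<inter> interior J' = {}"
    if "K \<in> D" "K' \<in> D" "J \<in> E K" "J' \<in> E K'" "K \<noteq> K'" for K K' J J'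
  proof -
    have "J \<subseteq> K" "J' \<subseteq> K'"
      using division_ofD(2)[OF E] that by blast+
    then show ?thesis
      using division_ofD(5)[OF D that(1,2,5)] interior_mono by blast
  qed
  show div: "(\<Union>K\<in>D. E K) division_of S"
  proof (rule division_ofI)
    show "finite (\<Union>K\<in>D. E K)"
      using division_ofD(1)[OF D] division_ofD(1)[OF E] by auto
    have "\<Union>(E K) = K" if "K \<in> D" for K
      using division_ofD(6)[OF E[OF that]] .
    then show "\<Union>(\<Union>K\<in>D. E K) = S"
      unfolding division_ofD(6)[OF D, symmetric] by blast
    show "interior K1 \<inter> interior K2 = {}"
      if "K1 \<in> (\<Union>K\<in>D. E K)" "K2 \<in> (\<Union>K\<in>D. E K)" "K1 \<noteq> K2" for K1 K2
      using that ints division_ofD(5)[OF E] by (metis UN_E)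
    show "K \<subseteq> S" if "K \<in> (\<Union>K\<in>D. E K)" for K
      using that division_ofD(2)[OF E] division_ofD(2)[OF D] by blast
    show "K \<noteq> {}" if "K \<in> (\<Union>K\<in>D. E K)" for K
      using that division_ofD(3)[OF E] by blast
    show "\<exists>a b. K = cbox a b" if "K \<in> (\<Union>K\<in>D. E K)" for K
      using that division_ofD(4)[OF E] by blast
  qed
  show "(\<Sum>K\<in>D. variation g (E K)) = variation g (\<Union>K\<in>D. E K)"
  proof -
    \<comment> \<open>A degenerate cell can occur in \<open>E K\<close> for two neighbouring
      \<open>K\<close>, so the families are disjoint only after intersecting with \<open>N\<close>.
      The cells discarded in this way carry no variation.\<close>
    define N where "N = {J :: real set. Inf J < Sup J}"
    have nz: "variation g F = variation g (F \<inter> N)" if "F division_of T" for F T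
      unfolding variation_def
    proof (rule sum.mono_neutral_right)
      show "\<forall>i\<in>F - F \<inter> N. \<bar>g (Sup i) - g (Inf i)\<bar> = 0"
      proof
        fix J assume "J \<in> F - F \<inter> N"
        then have "Sup J = Inf J"
          using division_interval_real(2)[OF that, of J] by (simp add: N_def)
        then show "\<bar>g (Sup J) - g (Inf J)\<bar> = 0" by simp
      qed
    qed (use that in auto)
    have "variation g (\<Union>K\<in>D. E K) = variation g (\<Union>K\<in>D. E K \<inter> N)"
      using nz[OF div] by (simp add: Int_UN_distrib2)
    also have "\<dots> = (\<Sum>K\<in>D. variation g (E K \<inter> N))"
      unfolding variation_def
    proof (rule sum.UNION_disjoint)
      show "\<forall>i\<in>D. \<forall>j\<in>D. i \<noteq> j \<longrightarrow> (E i \<inter> N) \<inter> (E j \<inter> N) = {}"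
      proof (intro ballI impI equals0I)
        fix i j J assume *: "i \<in> D" "j \<in> D" "i \<noteq> j" "J \<in> E i \<inter> N \<inter> (E j \<inter> N)"
        then have "interior J = {}" using ints[of i j J J] by auto
        moreover have "interior J = {Inf J<..<Sup J}"
          using division_interval_real(1)[OF E[OF *(1)], of J] * by (metis IntD1 interior_atLeastAtMost_real)
        ultimately show False using * by (auto simp: N_def)
      qed
    qed (use division_ofD(1)[OF D] division_ofD(1)[OF E] in auto)
    also have "\<dots> = (\<Sum>K\<in>D. variation g (E K))"
      using nz[OF E] by simp
    finally show ?thesis by simp
  qed
qed

lemma sum_UN_le:
  fixes f :: "'a \<Rightarrow> real"
  assumes "finite D" "\<And>K. K \<in> D \<Longrightarrow> finite (H K)" "\<And>x. x \<in> (\<Union>K\<in>D. H K) \<Longrightarrow> 0 \<le> f x"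
  shows "sum f (\<Union>K\<in>D. H K) \<le> (\<Sum>K\<in>D. sum f (H K))"
  using assms
proof (induction D)
  case (insert K D)
  have "sum f (\<Union>K\<in>insert K D. H K) = sum f (H K) + sum f (\<Union>K\<in>D. H K) - sum f (H K \<inter> (\<Union>K\<in>D. H K))"
    using insert.prems insert.hyps by (simp add: sum_Un)
  moreover have "0 \<le> sum f (H K \<inter> (\<Union>K\<in>D. H K))"
    using insert.prems by (intro sum_nonneg) auto
  moreover have "sum f (\<Union>K\<in>D. H K) \<le> (\<Sum>K\<in>D. sum f (H K))"
    by (rule insert.IH) (use insert.prems in auto)
  ultimately show ?case
    using insert.hyps by simp
qed simp

text \<open>Inside a cell of \<open>D\<close> on which \<open>g\<close> increases overall, every subinterval on which \<open>g\<close> drops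
  by \<open>\<alpha>\<close> times its length raises the variation of a refinement by twice that amount. A
  division of nearly maximal variation therefore leaves little room for such subintervals.\<close>

lemma opposite_slopes_bound:
  assumes D: "D division_of {u..v}" and V: "\<And>D'. D' division_of {u..v} \<Longrightarrow> variation g D' \<le> V"
    and \<alpha>: "\<alpha> > 0"
    and F: "finite F" "pairwise (\<lambda>p q. disjnt {fst p..snd p} {fst q..snd q}) F"
    and G: "\<And>s t. (s, t) \<in> F \<Longrightarrow> s < t \<and> (\<exists>K\<in>D. {s..t} \<subseteq> K \<and>
      (if g (Sup K) \<ge> g (Inf K) then g t - g s \<le> - \<alpha> * (t - s) else g t - g s \<ge> \<alpha> * (t - s)))"
  shows "2 * \<alpha> * (\<Sum>(s,t)\<in>F. t - s) \<le> V - variation g D"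
proof -
  define H where "H = (\<lambda>K. {p \<in> F. {fst p..snd p} \<subseteq> K \<and>
      (if g (Sup K) \<ge> g (Inf K) then g (snd p) - g (fst p) \<le> - \<alpha> * (snd p - fst p)
       else g (snd p) - g (fst p) \<ge> \<alpha> * (snd p - fst p))})"
  have finH: "finite (H K)" for K using F(1) by (auto simp: H_def)
  have inj: "inj_on (\<lambda>p. {fst p..snd p}) F"
  proof (rule inj_onI)
    fix p q assume "p \<in> F" "q \<in> F" and eq: "{fst p..snd p} = {fst q..snd q}"
    moreover have "fst p < snd p" "fst q < snd q"
      using G[of "fst p" "snd p"] G[of "fst q" "snd q"] \<open>p \<in> F\<close> \<open>q \<in> F\<close> by simp_all
    ultimately show "p = q" by (simp add: prod_eq_iff Icc_eq_Icc)
  qed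
  have "\<exists>E. E division_of K \<and> \<bar>g (Sup K) - g (Inf K)\<bar> + 2 * \<alpha> * (\<Sum>p\<in>H K. snd p - fst p) \<le> variation g E"
    if K: "K \<in> D" for K
  proof -
    let ?I = "(\<lambda>p. {fst p..snd p}) ` H K"
    note Ki = division_interval_real[OF D K]
    have injH: "inj_on (\<lambda>p. {fst p..snd p}) (H K)"
      using inj by (rule inj_on_subset) (auto simp: H_def)
    have "?I division_of \<Union>?I"
    proof (rule division_ofI)
      show "interior K1 \<inter> interior K2 = {}" if "K1 \<in> ?I" "K2 \<in> ?I" "K1 \<noteq> K2" for K1 K2
      proof -
        obtain p q where "p \<in> F" "q \<in> F" "K1 = {fst p..snd p}" "K2 = {fst q..snd q}"
          using \<open>K1 \<in> ?I\<close> \<open>K2 \<in> ?I\<close> unfolding H_def by blast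
        then have "disjnt K1 K2"
          using pairwiseD[OF F(2)] \<open>K1 \<noteq> K2\<close> by metis
        then have "K1 \<inter> K2 = {}"
          by (simp add: disjnt_def)
        then show ?thesis using interior_subset by blast
      qed
      show "K' \<noteq> {}" if "K' \<in> ?I" for K'
      proof -
        obtain p where "p \<in> F" "K' = {fst p..snd p}"
          using \<open>K' \<in> ?I\<close> unfolding H_def by blast
        then show ?thesis using G[of "fst p" "snd p"] by simp
      qed
      show "\<exists>a b. K' = cbox a b" if "K' \<in> ?I" for K'
        using that by auto
    qed (use finH in auto)
    moreover have "\<Union>?I \<subseteq> cbox (Inf K) (Sup K)"
      using Ki(1) by (auto simp: H_def)
    \<comment> \<open>The disjoint intervals become cells of a division of \<open>K\<close>. The
      other cells must make up the total change over \<open>K\<close> plus what the opposing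
      intervals lose.\<close>
    ultimately obtain E where E: "?I \<subseteq> E" "E division_of cbox (Inf K) (Sup K)"
      by (rule partial_division_extend_interval)
    have E': "E division_of {Inf K..Sup K}" "finite E"
      using E(2) by auto
    define \<Delta> where "\<Delta> = (\<lambda>J. g (Sup J) - g (Inf J))"
    \<comment> \<open>\<open>\<sigma>\<close> orients \<open>K\<close> so that \<open>g\<close>
      rises along it. Opposing cells are estimated with \<open>- \<sigma>\<close>, all others with
      \<open>\<sigma>\<close>, so the loss on the former counts twice: as variation and as a rise to
      be recovered.\<close>
    define \<sigma> :: real where "\<sigma> = (if g (Sup K) \<ge> g (Inf K) then 1 else - 1)"
    have \<sigma>: "\<bar>x\<bar> \<ge> \<sigma> * x" "\<bar>x\<bar> \<ge> - \<sigma> * x" for x by (auto simp: \<sigma>_def)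
    have "variation g E = (\<Sum>J\<in>?I. \<bar>\<Delta> J\<bar>) + (\<Sum>J\<in>E - ?I. \<bar>\<Delta> J\<bar>)"
      unfolding variation_def \<Delta>_def
      using sum.subset_diff[OF E(1) E'(2), of "\<lambda>J. \<bar>g (Sup J) - g (Inf J)\<bar>"] by simp
    moreover have "(\<Sum>J\<in>E - ?I. \<bar>\<Delta> J\<bar>) \<ge> \<sigma> * (\<Sum>J\<in>E - ?I. \<Delta> J)"
      unfolding sum_distrib_left using \<sigma>(1) by (intro sum_mono) auto
    moreover have "(\<Sum>J\<in>?I. \<bar>\<Delta> J\<bar>) \<ge> - \<sigma> * (\<Sum>J\<in>?I. \<Delta> J)"
      unfolding sum_distrib_left using \<sigma>(2) by (intro sum_mono) auto
    moreover have "(\<Sum>J\<in>E - ?I. \<Delta> J) = \<Delta> K - (\<Sum>J\<in>?I. \<Delta> J)"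
      using sum_division_telescope[OF E'(1) Ki(2), of g] sum.subset_diff[OF E(1) E'(2), of \<Delta>]
      by (simp add: \<Delta>_def)
    moreover have "- \<sigma> * (\<Sum>J\<in>?I. \<Delta> J) \<ge> \<alpha> * (\<Sum>p\<in>H K. snd p - fst p)"
    proof -
      have "(\<Sum>J\<in>?I. \<Delta> J) = (\<Sum>p\<in>H K. \<Delta> {fst p..snd p})"
        using sum.reindex[OF injH, of \<Delta>] by simp
      moreover have "\<alpha> * (snd p - fst p) \<le> - \<sigma> * \<Delta> {fst p..snd p}" if "p \<in> H K" for p
        using that G[of "fst p" "snd p"] by (auto simp: H_def \<Delta>_def \<sigma>_def split: if_splits)
      ultimately show ?thesis
        by (simp add: sum_distrib_left sum_mono flip: sum_negf)
    qed
    moreover have "\<sigma> * \<Delta> K = \<bar>g (Sup K) - g (Inf K)\<bar>"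
      by (auto simp: \<sigma>_def \<Delta>_def)
    ultimately have "\<bar>g (Sup K) - g (Inf K)\<bar> + 2 * \<alpha> * (\<Sum>p\<in>H K. snd p - fst p) \<le> variation g E"
      by (simp add: algebra_simps)
    then show ?thesis using E'(1) Ki(1) by auto
  qed
  then obtain E where E: "\<And>K. K \<in> D \<Longrightarrow> E K division_of K"
    "\<And>K. K \<in> D \<Longrightarrow> \<bar>g (Sup K) - g (Inf K)\<bar> + 2 * \<alpha> * (\<Sum>p\<in>H K. snd p - fst p) \<le> variation g (E K)"
    by metis
  have "(\<Sum>(s,t)\<in>F. t - s) = (\<Sum>p\<in>(\<Union>K\<in>D. H K). snd p - fst p)"
  proof (rule sum.cong)
    have "p \<in> (\<Union>K\<in>D. H K)" if "p \<in> F" for p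
      using G[of "fst p" "snd p"] that unfolding H_def UN_iff mem_Collect_eq prod.collapse by blast
    moreover have "H K \<subseteq> F" for K
      unfolding H_def by blast
    ultimately show "F = (\<Union>K\<in>D. H K)"
      by blast
  qed (simp add: case_prod_unfold)
  \<comment> \<open>Only an upper bound is needed, so disjointness of the sets \<open>H K\<close>
    does not have to be shown.\<close>
  also have "\<dots> \<le> (\<Sum>K\<in>D. \<Sum>p\<in>H K. snd p - fst p)"
  proof (rule sum_UN_le)
    show "0 \<le> snd p - fst p" if "p \<in> (\<Union>K\<in>D. H K)" for p
      using that G[of "fst p" "snd p"] by (auto simp: H_def)
  qed (use finH D in auto)
  finally have "2 * \<alpha> * (\<Sum>(s,t)\<in>F. t - s) \<le> 2 * \<alpha> * (\<Sum>K\<in>D. \<Sum>p\<in>H K. snd p - fst p)"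
    using \<alpha> by simp
  also have "\<dots> \<le> (\<Sum>K\<in>D. variation g (E K) - \<bar>g (Sup K) - g (Inf K)\<bar>)"
    unfolding sum_distrib_left[of "2*\<alpha>"] using E(2) by (intro sum_mono) (simp add: algebra_simps sum_distrib_left)
  also have "\<dots> = variation g (\<Union>K\<in>D. E K) - variation g D"
    by (simp add: sum_subtractf division_refine_Union(2)[OF D E(1)] variation_def[of g D])
  also have "\<dots> \<le> V - variation g D"
    using V[OF division_refine_Union(1)[OF D E(1)]] by simp
  finally show ?thesis .
qed

text \<open>Take a division whose variation is within \<open>2 * \<alpha> * e\<close> of the
  supremum. Apart from the finitely many end points of cells, \<open>E\<close> has a Vitali covering
  by intervals inside single cells whose slope opposes the change over the cell, and
  \<open>opposite_slopes_bound\<close> limits their total length to \<open>e\<close>.\<close>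

lemma bounded_variation_opposite_slopes_negligible:
  assumes bv: "bounded_variation_Icc u v g" and "u < v" and \<alpha>: "\<alpha> > 0"
    and E: "E \<subseteq> {u<..<v}"
    and neg: "\<And>x d. x \<in> E \<Longrightarrow> d > 0 \<Longrightarrow> \<exists>s t. s < t \<and> x \<in> {s..t} \<and> t - s < d \<and> g t - g s \<le> - \<alpha> * (t - s)"
    and pos: "\<And>x d. x \<in> E \<Longrightarrow> d > 0 \<Longrightarrow> \<exists>s t. s < t \<and> x \<in> {s..t} \<and> t - s < d \<and> g t - g s \<ge> \<alpha> * (t - s)"
  shows "negligible E"
proof -
  define X where "X = {variation g D |D. D division_of {u..v}}"
  define V where "V = Sup X"
  have bdd: "bdd_above X"
    using bv unfolding bounded_variation_Icc_def X_def by (auto intro: bdd_aboveI)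
  have ne: "X \<noteq> {}"
    unfolding X_def using elementary_interval[of u v] by auto
  have V: "variation g D \<le> V" if "D division_of {u..v}" for D
    unfolding V_def using bdd that by (intro cSup_upper) (auto simp: X_def)
  define Q where "Q = (\<lambda>e T. \<exists>N. finite N \<and> E - N \<subseteq> T \<and> T \<in> lmeasurable \<and> measure lebesgue T \<le> e)"
  have *: "\<exists>T. Q e T" if e: "e > 0" for e
  proof -
    have "\<exists>y\<in>X. V - 2 * \<alpha> * e < y"
      using e \<alpha> ne less_cSup_iff[OF ne bdd, of "V - 2 * \<alpha> * e"] unfolding V_def by simp
    then obtain D where D: "D division_of {u..v}" "V - 2 * \<alpha> * e < variation g D"
      unfolding X_def by auto
    define N where "N = Inf ` D \<union> Sup ` D"
    define G where "G = (\<lambda>s t. \<exists>K\<in>D. {s..t} \<subseteq> K \<and>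
      (if g (Sup K) \<ge> g (Inf K) then g t - g s \<le> - \<alpha> * (t - s) else g t - g s \<ge> \<alpha> * (t - s)))"
    have "\<exists>T. E - N \<subseteq> T \<and> T \<in> lmeasurable \<and> measure lebesgue T \<le> e"
    proof (rule Vitali_outer_bound[where G = G])
      fix x d :: real assume x: "x \<in> E - N" and d: "d > 0"
      obtain K where K: "K \<in> D" "x \<in> K"
        using x E division_ofD(6)[OF D(1)] by force
      have Ki: "K = {Inf K..Sup K}"
        using division_interval_real[OF D(1) K(1)] by simp
      have "x \<noteq> Inf K" "x \<noteq> Sup K"
        using x K by (auto simp: N_def)
      moreover have "Inf K \<le> x" "x \<le> Sup K"
        using K(2) Ki by (metis atLeastAtMost_iff)+
      ultimately have xK: "Inf K < x" "x < Sup K"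
        by auto
      \<comment> \<open>Shrinking \<open>d\<close> to the distance from the ends of \<open>K\<close>
        keeps the interval inside \<open>K\<close>.\<close>
      let ?d = "min d (min (x - Inf K) (Sup K - x))"
      have d': "?d > 0" using d xK by simp
      obtain s t where st: "s < t" "x \<in> {s..t}" "t - s < ?d"
        "if g (Sup K) \<ge> g (Inf K) then g t - g s \<le> - \<alpha> * (t - s) else g t - g s \<ge> \<alpha> * (t - s)"
        \<comment> \<open>Slopes of both signs occur near \<open>x\<close>; the one opposing the
          change of \<open>g\<close> over \<open>K\<close> is selected.\<close>
        using neg[of x, OF _ d'] pos[of x, OF _ d'] x by (metis DiffD1)
      have "{s..t} \<subseteq> {Inf K..Sup K}"
        using st by auto
      then have "{s..t} \<subseteq> K"
        using Ki by metis
      then have "G s t"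
        unfolding G_def using st K by blast
      then show "\<exists>s t. G s t \<and> s < t \<and> x \<in> {s..t} \<and> t - s < d"
        using st(1-3) by (intro exI[of _ s] exI[of _ t]) simp
    next
      fix F assume F: "finite F" "\<And>s t. (s, t) \<in> F \<Longrightarrow> G s t \<and> s < t"
        "pairwise (\<lambda>p q. disjnt {fst p..snd p} {fst q..snd q}) F"
      have "2 * \<alpha> * (\<Sum>(s,t)\<in>F. t - s) \<le> V - variation g D"
        by (rule opposite_slopes_bound[OF D(1) V \<alpha> F(1,3)]) (use F(2) in \<open>auto simp: G_def\<close>)
      also have "\<dots> \<le> 2 * \<alpha> * e" using D(2) by simp
      finally show "(\<Sum>(s,t)\<in>F. t - s) \<le> e" using \<alpha> by simp
    qed
    moreover have "finite N" using D(1) by (auto simp: N_def)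
    ultimately show ?thesis unfolding Q_def by blast
  qed
  show ?thesis
    unfolding negligible_outer_le
  proof (intro allI impI)
    fix e :: real assume "e > 0"
    then obtain T N where T: "finite N" "E - N \<subseteq> T" "T \<in> lmeasurable" "measure lebesgue T \<le> e"
      using * unfolding Q_def by metis
    have N: "negligible N" using T(1) by (rule negligible_finite)
    have "measure lebesgue (T \<union> N) \<le> measure lebesgue T + measure lebesgue N"
      using T(3) negligible_imp_measurable[OF N] by (intro measure_Un_le) auto
    then have "measure lebesgue (T \<union> N) \<le> e"
      using T(4) negligible_imp_measure0[OF N] by simp
    moreover have "T \<union> N \<in> lmeasurable"
      using T(3) negligible_imp_measurable[OF N] by (rule fmeasurable.Un)
    ultimately show "\<exists>T. E \<subseteq> T \<and> T \<in> lmeasurable \<and> measure lebesgue T \<le> e"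
      using T(2) by (intro exI[of _ "T \<union> N"]) auto
  qed
qed

text \<open>Disjoint intervals with slopes of modulus at least \<open>M\<close> extend to a
  division, so their total length is at most \<open>B / M\<close>, where \<open>B\<close> bounds the
  variation. Here \<open>M\<close> is arbitrary.\<close>

lemma bounded_variation_steep_negligible:
  assumes bv: "bounded_variation_Icc u v g" and "u < v"
    and E: "E \<subseteq> {u<..<v}"
    and steep: "\<And>x d M. x \<in> E \<Longrightarrow> d > 0 \<Longrightarrow> \<exists>s t. s < t \<and> x \<in> {s..t} \<and> t - s < d \<and> \<bar>g t - g s\<bar> \<ge> M * (t - s)"
  shows "negligible E"
  unfolding negligible_outer_le
proof (intro allI impI)
  obtain B where B: "\<And>D. D division_of {u..v} \<Longrightarrow> variation g D \<le> B"
    using bv unfolding bounded_variation_Icc_def by auto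
  fix e :: real assume e: "e > 0"
  \<comment> \<open>The summand 1 keeps \<open>M\<close> positive when \<open>B\<close> vanishes,
    and \<open>M * e\<close> still dominates \<open>B\<close>.\<close>
  define M where "M = (\<bar>B\<bar> + 1) / e"
  have M: "M > 0" using e by (simp add: M_def)
  define G where "G = (\<lambda>s t. {s..t} \<subseteq> {u..v} \<and> \<bar>g t - g s\<bar> \<ge> M * (t - s))"
  show "\<exists>T. E \<subseteq> T \<and> T \<in> lmeasurable \<and> measure lebesgue T \<le> e"
  proof (rule Vitali_outer_bound[where G = G])
    fix x d :: real assume x: "x \<in> E" and d: "d > 0"
    let ?d = "min d (min (x - u) (v - x))"
    have "?d > 0" using E x d by auto
    then obtain s t where st: "s < t" "x \<in> {s..t}" "t - s < ?d" "\<bar>g t - g s\<bar> \<ge> M * (t - s)"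
      using steep x by blast
    then show "\<exists>s t. G s t \<and> s < t \<and> x \<in> {s..t} \<and> t - s < d"
      unfolding G_def by (intro exI[of _ s] exI[of _ t]) auto
  next
    fix F assume F: "finite F" "\<And>s t. (s, t) \<in> F \<Longrightarrow> G s t \<and> s < t"
      "pairwise (\<lambda>p q. disjnt {fst p..snd p} {fst q..snd q}) F"
    let ?I = "(\<lambda>p. {fst p..snd p}) ` F"
    have Fp: "fst p < snd p" "{fst p..snd p} \<subseteq> {u..v}"
      "\<bar>g (snd p) - g (fst p)\<bar> \<ge> M * (snd p - fst p)" if "p \<in> F" for p
      using F(2)[of "fst p" "snd p"] that by (simp_all add: G_def)
    have inj: "inj_on (\<lambda>p. {fst p..snd p}) F"
    proof (rule inj_onI)
      fix p q assume "p \<in> F" "q \<in> F" and eq: "{fst p..snd p} = {fst q..snd q}"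
      with Fp(1)[of p] Fp(1)[of q] show "p = q" by (simp add: prod_eq_iff Icc_eq_Icc)
    qed
    have "?I division_of \<Union>?I"
    proof (rule division_ofI)
      show "interior K1 \<inter> interior K2 = {}" if "K1 \<in> ?I" "K2 \<in> ?I" "K1 \<noteq> K2" for K1 K2
      proof -
        obtain p q where "p \<in> F" "q \<in> F" "K1 = {fst p..snd p}" "K2 = {fst q..snd q}"
          using \<open>K1 \<in> ?I\<close> \<open>K2 \<in> ?I\<close> by blast
        then have "disjnt K1 K2"
          using pairwiseD[OF F(3)] \<open>K1 \<noteq> K2\<close> by metis
        then have "K1 \<inter> K2 = {}"
          by (simp add: disjnt_def)
        then show ?thesis using interior_subset by blast
      qed
      show "K \<noteq> {}" if "K \<in> ?I" for K
        using that Fp(1) by (auto simp: less_imp_le)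
      show "\<exists>a b. K = cbox a b" if "K \<in> ?I" for K
        using that by auto
    qed (use F(1) in auto)
    moreover have "\<Union>?I \<subseteq> cbox u v"
      using Fp(2) by fastforce
    ultimately obtain D where D: "?I \<subseteq> D" "D division_of cbox u v"
      by (rule partial_division_extend_interval)
    have "M * (\<Sum>(s,t)\<in>F. t - s) \<le> (\<Sum>p\<in>F. \<bar>g (snd p) - g (fst p)\<bar>)"
      unfolding sum_distrib_left case_prod_unfold using Fp(3) by (intro sum_mono) auto
    also have "\<dots> = (\<Sum>J\<in>?I. \<bar>g (Sup J) - g (Inf J)\<bar>)"
      using Fp(1) by (subst sum.reindex[OF inj]) (auto intro!: sum.cong simp: less_imp_le)
    also have "\<dots> \<le> variation g D"
      unfolding variation_def using D by (intro sum_mono2) auto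
    also have "\<dots> \<le> B" using B D(2) by simp
    also have "\<dots> \<le> M * e" using e by (simp add: M_def)
    finally show "(\<Sum>(s,t)\<in>F. t - s) \<le> e" using M by simp
  qed
qed

text \<open>Subtracting a line centres slopes: oscillation between \<open>p\<close> and
  \<open>q\<close> becomes oscillation between \<open>- (q - p) / 2\<close> and
  \<open>(q - p) / 2\<close>.\<close>

lemma bounded_variation_diff_linear:
  assumes "bounded_variation_Icc u v g" "u \<le> v"
  shows "bounded_variation_Icc u v (\<lambda>x. g x - m * x)"
proof -
  obtain B where B: "\<And>D. D division_of {u..v} \<Longrightarrow> variation g D \<le> B"
    using assms unfolding bounded_variation_Icc_def by auto
  have "variation (\<lambda>x. g x - m * x) D \<le> B + \<bar>m\<bar> * (v - u)" if D: "D division_of {u..v}" for D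
  proof -
    have "variation (\<lambda>x. g x - m * x) D \<le> (\<Sum>K\<in>D. \<bar>g (Sup K) - g (Inf K)\<bar> + \<bar>m\<bar> * (Sup K - Inf K))"
      unfolding variation_def
    proof (rule sum_mono)
      fix K assume "K \<in> D"
      then have "Inf K \<le> Sup K" using division_interval_real(2)[OF D] by blast
      then have "\<bar>m\<bar> * (Sup K - Inf K) = \<bar>m * (Sup K - Inf K)\<bar>" by (simp add: abs_mult)
      then show "\<bar>g (Sup K) - m * Sup K - (g (Inf K) - m * Inf K)\<bar> \<le> \<bar>g (Sup K) - g (Inf K)\<bar> + \<bar>m\<bar> * (Sup K - Inf K)"
        by (simp add: algebra_simps)
    qed
    also have "\<dots> = variation g D + \<bar>m\<bar> * (v - u)"
      using sum_division_telescope[OF D assms(2), of "\<lambda>x. x"]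
      by (simp add: variation_def sum.distrib flip: sum_distrib_left)
    finally show ?thesis using B[OF D] by simp
  qed
  then show ?thesis unfolding bounded_variation_Icc_def by blast
qed

section \<open>Difference quotients and differentiability almost everywhere\<close>

text \<open>Compare the lower and upper limits of the difference quotient in the extended reals. If
  they differ, two rationals fit strictly between them; if they agree, the common value is infinite,
  as a finite one would be the derivative. Rational thresholds keep the family of exceptional sets
  countable.\<close>

lemma not_differentiable_slopes:
  fixes g :: "real \<Rightarrow> real"
  assumes "\<not> g differentiable (at x)"
  shows "(\<forall>M. \<exists>\<^sub>F h in at 0. \<bar>(g (x + h) - g x) / h\<bar> > M) \<or>
    (\<exists>p\<in>\<rat>. \<exists>q\<in>\<rat>. p < q \<and> (\<exists>\<^sub>F h in at 0. (g (x + h) - g x) / h < p) \<and> (\<exists>\<^sub>F h in at 0. (g (x + h) - g x) / h > q))"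
proof -
  define \<phi> where "\<phi> = (\<lambda>h. (g (x + h) - g x) / h)"
  define L where "L = Liminf (at 0) (\<lambda>h. ereal (\<phi> h))"
  define U where "U = Limsup (at 0) (\<lambda>h. ereal (\<phi> h))"
  have nt: "at (0::real) \<noteq> bot" by simp
  have LU: "L \<le> U" unfolding L_def U_def by (rule Liminf_le_Limsup[OF nt])
  show ?thesis
  proof (cases "L < U")
    case True
    obtain p' where p': "L < ereal p'" "ereal p' < U" using ereal_dense2[OF True] by auto
    obtain q' where q': "ereal p' < ereal q'" "ereal q' < U" using ereal_dense2[OF p'(2)] by auto
    obtain m' where m': "p' < m'" "m' < q'" using q'(1) dense[of p' q'] by auto
    obtain p where p: "p \<in> \<rat>" "p' < p" "p < m'" using Rats_dense_in_real[OF m'(1)] by auto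
    obtain q where q: "q \<in> \<rat>" "m' < q" "q < q'" using Rats_dense_in_real[OF m'(2)] by auto
    have Lp: "L < ereal p" using p'(1) p(2) by (meson ereal_less(1) less_ereal.simps(1) less_trans)
    have qU: "ereal q < U" using q'(2) q(3) by (meson less_ereal.simps(1) less_trans)
    have "\<exists>\<^sub>F h in at 0. \<phi> h < p"
    proof (rule ccontr)
      assume "\<not> ?thesis"
      then have "\<forall>\<^sub>F h in at 0. ereal p \<le> ereal (\<phi> h)"
        by (simp add: not_frequently not_less)
      then have "ereal p \<le> L" unfolding L_def by (rule Liminf_bounded)
      with Lp show False by simp
    qed
    moreover have "\<exists>\<^sub>F h in at 0. q < \<phi> h"
    proof (rule ccontr)
      assume "\<not> ?thesis"
      then have "\<forall>\<^sub>F h in at 0. ereal (\<phi> h) \<le> ereal q"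
        by (simp add: not_frequently not_less)
      then have "U \<le> ereal q" unfolding U_def by (rule Limsup_bounded)
      with qU show False by simp
    qed
    ultimately show ?thesis
      using p q unfolding \<phi>_def by (meson less_trans)
  next
    case False
    then have eq: "L = U" using LU by simp
    have lim: "((\<lambda>h. ereal (\<phi> h)) \<longlongrightarrow> U) (at 0)"
      using eq by (intro Liminf_eq_Limsup[OF nt]) (simp_all add: L_def U_def)
    show ?thesis
    proof (cases U)
      case (real D)
      then have "(\<phi> \<longlongrightarrow> D) (at 0)" using lim by simp
      then have "(g has_field_derivative D) (at x)"
        unfolding DERIV_def \<phi>_def .
      with assms show ?thesis
        by (auto simp: real_differentiable_def)
    next
      case PInf
      have "\<exists>\<^sub>F h in at 0. M < \<bar>\<phi> h\<bar>" for M
      proof -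
        have "\<forall>\<^sub>F h in at 0. ereal M < ereal (\<phi> h)"
          using order_tendstoD(1)[OF lim, of "ereal M"] PInf by simp
        then have "\<forall>\<^sub>F h in at 0. M < \<bar>\<phi> h\<bar>" by eventually_elim simp
        then show ?thesis using eventually_frequently nt by blast
      qed
      then show ?thesis unfolding \<phi>_def by blast
    next
      case MInf
      have "\<exists>\<^sub>F h in at 0. M < \<bar>\<phi> h\<bar>" for M
      proof -
        have "\<forall>\<^sub>F h in at 0. ereal (\<phi> h) < ereal (- M)"
          using order_tendstoD(2)[OF lim, of "ereal (- M)"] MInf by simp
        then have "\<forall>\<^sub>F h in at 0. M < \<bar>\<phi> h\<bar>" by eventually_elim simp
        then show ?thesis using eventually_frequently nt by blast
      qed
      then show ?thesis unfolding \<phi>_def by blast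
    qed
  qed
qed

text \<open>A difference quotient with step \<open>h\<close> of either sign is the slope over an
  interval having \<open>x\<close> as an end point, which is the form a Vitali covering
  requires.\<close>

lemma frequently_slope_interval:
  fixes g :: "real \<Rightarrow> real"
  assumes "\<exists>\<^sub>F h in at 0. P ((g (x + h) - g x) / h)" "d > 0"
  obtains s t where "s < t" "x \<in> {s..t}" "t - s < d" "P ((g t - g s) / (t - s))"
proof -
  have "\<forall>\<^sub>F h in at (0::real). h \<noteq> 0 \<and> \<bar>h\<bar> < d"
    unfolding eventually_at using \<open>d > 0\<close> by (intro exI[of _ d]) (auto simp: dist_real_def)
  from frequently_rev_mp[OF assms(1), of "\<lambda>h. h \<noteq> 0 \<and> \<bar>h\<bar> < d \<and> P ((g (x + h) - g x) / h)"] this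
  have "\<exists>\<^sub>F h in at 0. h \<noteq> 0 \<and> \<bar>h\<bar> < d \<and> P ((g (x + h) - g x) / h)"
    by (simp add: eventually_mono)
  then obtain h where h: "h \<noteq> 0" "\<bar>h\<bar> < d" "P ((g (x + h) - g x) / h)"
    using frequently_ex by blast
  show thesis
  proof (cases "h > 0")
    case True
    then show thesis using that[of x "x + h"] h by auto
  next
    case False
    have "(g x - g (x + h)) / (x - (x + h)) = (g (x + h) - g x) / h"
      using h(1) by (simp add: field_simps)
    then show thesis using that[of "x + h" x] h False by auto
  qed
qed

text \<open>Lebesgue's differentiation theorem. The points of unbounded slope form a null set, and
  so do the points where slopes oscillate across \<open>p < q\<close>; countably many rational pairs
  suffice.\<close>

theorem bounded_variation_differentiable_ae:
  assumes bv: "bounded_variation_Icc u v g" and "u < v"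
  shows "negligible {x \<in> {u<..<v}. \<not> g differentiable (at x)}"
proof -
  define A where "A = {x \<in> {u<..<v}. \<forall>M. \<exists>\<^sub>F h in at 0. \<bar>(g (x + h) - g x) / h\<bar> > M}"
  define B where "B = (\<lambda>p q. {x \<in> {u<..<v}. (\<exists>\<^sub>F h in at 0. (g (x + h) - g x) / h < p) \<and>
      (\<exists>\<^sub>F h in at 0. (g (x + h) - g x) / h > q)})"
  have "negligible A"
  proof (rule bounded_variation_steep_negligible[OF assms])
    fix x d M :: real assume x: "x \<in> A" and d: "d > 0"
    then have "\<exists>\<^sub>F h in at 0. \<bar>(g (x + h) - g x) / h\<bar> > M" by (simp add: A_def)
    then obtain s t where "s < t" "x \<in> {s..t}" "t - s < d" "\<bar>(g t - g s) / (t - s)\<bar> > M"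
      using d by (rule frequently_slope_interval)
    then show "\<exists>s t. s < t \<and> x \<in> {s..t} \<and> t - s < d \<and> \<bar>g t - g s\<bar> \<ge> M * (t - s)"
      by (intro exI[of _ s] exI[of _ t]) (auto simp: field_simps abs_divide)
  qed (auto simp: A_def)
  moreover have "negligible (B p q)" if "p < q" for p q
  proof (rule bounded_variation_opposite_slopes_negligible)
    let ?m = "(p + q) / 2"
    show "bounded_variation_Icc u v (\<lambda>x. g x - ?m * x)"
      by (rule bounded_variation_diff_linear[OF bv]) (use \<open>u < v\<close> in simp)
    show "(q - p) / 2 > 0" using that by simp
    fix x d :: real assume x: "x \<in> B p q" and d: "d > 0"
    have "\<exists>\<^sub>F h in at 0. (g (x + h) - g x) / h < p" using x by (simp add: B_def)
    then obtain s t where "s < t" "x \<in> {s..t}" "t - s < d" "(g t - g s) / (t - s) < p"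
      using d by (rule frequently_slope_interval)
    then show "\<exists>s t. s < t \<and> x \<in> {s..t} \<and> t - s < d \<and> (g t - ?m * t) - (g s - ?m * s) \<le> - ((q - p) / 2) * (t - s)"
      by (intro exI[of _ s] exI[of _ t]) (auto simp: field_simps)
    have "\<exists>\<^sub>F h in at 0. (g (x + h) - g x) / h > q" using x by (simp add: B_def)
    then obtain s t where "s < t" "x \<in> {s..t}" "t - s < d" "(g t - g s) / (t - s) > q"
      using d by (rule frequently_slope_interval)
    then show "\<exists>s t. s < t \<and> x \<in> {s..t} \<and> t - s < d \<and> (g t - ?m * t) - (g s - ?m * s) \<ge> ((q - p) / 2) * (t - s)"
      by (intro exI[of _ s] exI[of _ t]) (auto simp: field_simps)
  qed (use \<open>u < v\<close> in \<open>auto simp: B_def\<close>)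
  then have "negligible (\<Union>r\<in>{r \<in> \<rat> \<times> \<rat>. fst r < snd r}. B (fst r) (snd r))"
    by (intro negligible_countable_Union countable_image) (auto intro: countable_subset[OF _ countable_SIGMA[OF countable_rat countable_rat]])
  ultimately have "negligible (A \<union> (\<Union>r\<in>{r \<in> \<rat> \<times> \<rat>. fst r < snd r}. B (fst r) (snd r)))"
    by (rule negligible_Un)
  then show ?thesis
  proof (rule negligible_subset)
    show "{x \<in> {u<..<v}. \<not> g differentiable at x} \<subseteq> A \<union> (\<Union>r\<in>{r \<in> \<rat> \<times> \<rat>. fst r < snd r}. B (fst r) (snd r))"
    proof
      fix x assume "x \<in> {x \<in> {u<..<v}. \<not> g differentiable at x}"
      then have x: "x \<in> {u<..<v}" "\<not> g differentiable at x" by auto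
      from not_differentiable_slopes[OF x(2)]
      show "x \<in> A \<union> (\<Union>r\<in>{r \<in> \<rat> \<times> \<rat>. fst r < snd r}. B (fst r) (snd r))"
      proof
        assume "\<exists>p\<in>\<rat>. \<exists>q\<in>\<rat>. p < q \<and> (\<exists>\<^sub>F h in at 0. (g (x + h) - g x) / h < p) \<and> (\<exists>\<^sub>F h in at 0. (g (x + h) - g x) / h > q)"
        then obtain p q where "p \<in> \<rat>" "q \<in> \<rat>" "p < q" "x \<in> B p q"
          using x(1) unfolding B_def by blast
        then have "(p, q) \<in> {r \<in> \<rat> \<times> \<rat>. fst r < snd r}" "x \<in> B (fst (p, q)) (snd (p, q))" by auto
        then show ?thesis by blast
      qed (use x(1) in \<open>auto simp: A_def\<close>)
    qed
  qed
qed

section \<open>The fundamental theorem of calculus for absolutely continuous functions\<close>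

text \<open>Negligibility is a local property, so a short interval around each point suffices. On an
  interval shorter than the \<open>\<delta>\<close> belonging to tolerance 1, every division has
  variation below 1.\<close>

theorem abs_continuous_differentiable_ae:
  assumes ac: "abs_continuous_on_Icc c d g"
  shows "negligible {x \<in> {c<..<d}. \<not> g differentiable (at x)}"
proof (rule locally_negligible_alt[THEN iffD2], rule ballI)
  obtain \<delta> where \<delta>: "\<delta> > 0"
    and fam: "\<forall>(I :: real set set) s t. finite I \<longrightarrow> (\<forall>i\<in>I. c \<le> s i \<and> s i \<le> t i \<and> t i \<le> d) \<longrightarrow>
      (\<forall>i\<in>I. \<forall>j\<in>I. i \<noteq> j \<longrightarrow> {s i<..<t i} \<inter> {s j<..<t j} = {}) \<longrightarrow>
      (\<Sum>i\<in>I. t i - s i) < \<delta> \<longrightarrow> (\<Sum>i\<in>I. \<bar>g (t i) - g (s i)\<bar>) < 1"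
    by (rule abs_continuous_finite_family[OF ac zero_less_one])
  let ?S = "{x \<in> {c<..<d}. \<not> g differentiable (at x)}"
  fix x assume x: "x \<in> ?S"
  \<comment> \<open>One third of \<open>\<delta>\<close> on either side gives
    \<open>v - u < \<delta>\<close>.\<close>
  define u where "u = max c (x - \<delta> / 3)"
  define v where "v = min d (x + \<delta> / 3)"
  have uv: "c \<le> u" "u < x" "x < v" "v \<le> d" "v - u < \<delta>"
    using x \<delta> by (auto simp: u_def v_def)
  have "bounded_variation_Icc u v g"
    unfolding bounded_variation_Icc_def variation_def
  proof (intro exI allI impI)
    fix D assume D: "D division_of {u..v}"
    have "(\<Sum>K\<in>D. \<bar>g (Sup K) - g (Inf K)\<bar>) < 1"
    proof (rule fam[rule_format])
      show "finite D" using D by auto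
      show "c \<le> Inf K \<and> Inf K \<le> Sup K \<and> Sup K \<le> d" if "K \<in> D" for K
      proof -
        note K = division_interval_real[OF D that]
        have "{Inf K..Sup K} \<subseteq> {u..v}" using K(1,3) by simp
        then show ?thesis using K(2) uv by auto
      qed
      show "{Inf K<..<Sup K} \<inter> {Inf L<..<Sup L} = {}" if "K \<in> D" "L \<in> D" "K \<noteq> L" for K L
        using division_ofD(5)[OF D that] division_interval_real(1)[OF D that(1)]
          division_interval_real(1)[OF D that(2)] by (metis interior_atLeastAtMost_real)
      show "(\<Sum>K\<in>D. Sup K - Inf K) < \<delta>"
        using sum_division_telescope[OF D, of "\<lambda>x. x"] uv by simp
    qed
    then show "(\<Sum>K\<in>D. \<bar>g (Sup K) - g (Inf K)\<bar>) \<le> 1" by simp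
  qed
  then have "negligible {x \<in> {u<..<v}. \<not> g differentiable (at x)}"
    using uv by (intro bounded_variation_differentiable_ae) auto
  then have "negligible (?S \<inter> {u<..<v})"
    by (rule negligible_subset) auto
  moreover have "openin (top_of_set ?S) (?S \<inter> {u<..<v})"
    by (intro openin_open_Int) simp
  ultimately show "\<exists>U. openin (top_of_set ?S) U \<and> x \<in> U \<and> negligible U"
    using x uv by (intro exI[of _ "?S \<inter> {u<..<v}"]) auto
qed

text \<open>Supplies the gauge at the exceptional points in
  \<open>abs_continuous_FTC\<close>.\<close>

lemma negligible_outer_open:
  fixes N :: "real set"
  assumes "negligible N" "\<delta> > 0"
  obtains U where "open U" "N \<subseteq> U" "U \<in> lmeasurable" "measure lebesgue U < \<delta>"
proof -
  obtain T where T: "open T" "N \<subseteq> T" "T - N \<in> lmeasurable" "emeasure lebesgue (T - N) < ennreal \<delta>"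
    using sets_lebesgue_outer_open[OF negligible_imp_sets[OF assms(1)] assms(2)] by blast
  have eq: "T = (T - N) \<union> N" using T(2) by blast
  have Tm: "T \<in> lmeasurable"
    by (subst eq) (rule fmeasurable.Un[OF T(3) negligible_imp_measurable[OF assms(1)]])
  have "measure lebesgue T \<le> measure lebesgue (T - N) + measure lebesgue N"
    by (subst (1) eq, rule measure_Un_le)
      (use T(3) negligible_imp_measurable[OF assms(1)] in auto)
  also have "\<dots> = measure lebesgue (T - N)"
    using negligible_imp_measure0[OF assms(1)] by simp
  also have "\<dots> < \<delta>"
    using T(3,4) assms(2) by (simp add: emeasure_eq_measure2 ennreal_less_iff)
  finally show thesis using that T Tm by blast
qed

text \<open>The gauge has two pieces. Off \<open>N\<close>, differentiability makes each increment
  of \<open>g\<close> close to its linear prediction. At tags in \<open>N\<close> the cells lie in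
  an open set of measure below \<open>\<delta>\<close>, so absolute continuity makes the sum of
  their increments small.\<close>

theorem abs_continuous_FTC:
  fixes g :: "real \<Rightarrow> real"
  assumes ac: "abs_continuous_on_Icc c d g" and ab: "c \<le> a" "a \<le> b" "b \<le> d"
    and N: "negligible N"
    and deriv: "\<And>x. x \<in> {a..b} - N \<Longrightarrow> (g has_vector_derivative g' x) (at x within {a..b})"
  shows "(g' has_integral (g b - g a)) {a..b}"
proof -
  \<comment> \<open>The value 0 on \<open>N\<close> removes these tags from the Riemann sums; the
    spike rule restores \<open>g'\<close> at the end.\<close>
  define h where "h = (\<lambda>x. if x \<in> N then 0 else g' x)"
  have "(h has_integral (g b - g a)) (cbox a b)"
    unfolding has_integral
  proof (intro allI impI)
    fix e :: real assume e: "e > 0"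
    \<comment> \<open>With this \<open>\<eta>\<close> the linear errors add up to
      \<open>\<eta> * (b - a) \<le> e / 2\<close>; the added 1 covers \<open>a = b\<close>.\<close>
    define \<eta> where "\<eta> = e / (2 * (b - a + 1))"
    have \<eta>: "\<eta> > 0" using e ab by (simp add: \<eta>_def)
    have "\<forall>x. \<exists>\<rho>>0. x \<in> {a..b} - N \<longrightarrow>
         (\<forall>y\<in>{a..b}. norm (y-x) < \<rho> \<longrightarrow> norm (g y - g x - (y-x) *\<^sub>R g' x) \<le> \<eta> * norm (y-x))"
      using deriv[unfolded has_vector_derivative_def has_derivative_within_alt] \<eta>
      by (metis zero_less_one)
    then obtain \<rho> where \<rho>: "\<And>x. 0 < \<rho> x"
      "\<And>x y. x \<in> {a..b} - N \<Longrightarrow> y \<in> {a..b} \<Longrightarrow> \<bar>y - x\<bar> < \<rho> x \<Longrightarrow> \<bar>g y - g x - (y-x) * g' x\<bar> \<le> \<eta> * \<bar>y - x\<bar>"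
      by (metis real_norm_def real_scaleR_def)
    have e2: "e / 2 > 0" using e by simp
    obtain \<delta> where \<delta>: "\<delta> > 0"
      and fam: "\<forall>(I :: (real \<times> real set) set) s t. finite I \<longrightarrow> (\<forall>i\<in>I. c \<le> s i \<and> s i \<le> t i \<and> t i \<le> d) \<longrightarrow>
      (\<forall>i\<in>I. \<forall>j\<in>I. i \<noteq> j \<longrightarrow> {s i<..<t i} \<inter> {s j<..<t j} = {}) \<longrightarrow>
      (\<Sum>i\<in>I. t i - s i) < \<delta> \<longrightarrow> (\<Sum>i\<in>I. \<bar>g (t i) - g (s i)\<bar>) < e / 2"
      by (rule abs_continuous_finite_family[OF ac e2])
    obtain U where U: "open U" "N \<subseteq> U" "U \<in> lmeasurable" "measure lebesgue U < \<delta>"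
      using negligible_outer_open[OF N \<delta>] by blast
    define \<gamma> where "\<gamma> = (\<lambda>x. if x \<in> N then U else ball x (\<rho> x))"
    have gauge: "gauge \<gamma>"
      using U \<rho>(1) by (auto simp: gauge_def \<gamma>_def)
    have "norm ((\<Sum>(x, k)\<in>p. measure lborel k *\<^sub>R h x) - (g b - g a)) < e"
      if p: "p tagged_division_of cbox a b" and fine: "\<gamma> fine p" for p
    proof -
      have pI: "p tagged_division_of {a..b}" using p by simp
      note pD = tagged_division_ofD[OF p]
      define s where "s = (\<lambda>i::real \<times> real set. Inf (snd i))"
      define t where "t = (\<lambda>i::real \<times> real set. Sup (snd i))"
      define w where "w = (\<lambda>i::real \<times> real set. (t i - s i) * h (fst i) - (g (t i) - g (s i)))"
      have i: "snd i = {s i..t i}" "s i \<le> fst i" "fst i \<le> t i" "a \<le> s i" "t i \<le> b"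
        "snd i \<subseteq> \<gamma> (fst i)" if "i \<in> p" for i
      proof -
        have m: "(fst i, snd i) \<in> p" using that by simp
        obtain l r where lr: "snd i = {l..r}" using pD(4)[OF m] by auto
        moreover have "fst i \<in> snd i" "snd i \<subseteq> {a..b}" using pD(2,3)[OF m] by auto
        ultimately show "snd i = {s i..t i}" "s i \<le> fst i" "fst i \<le> t i" "a \<le> s i" "t i \<le> b"
          by (auto simp: s_def t_def)
        show "snd i \<subseteq> \<gamma> (fst i)" using fineD[OF fine m] .
      qed
      have st: "s i \<le> t i" if "i \<in> p" for i
        using i(2,3)[OF that] by (rule order_trans)
      have disj: "{s i<..<t i} \<inter> {s j<..<t j} = {}" if "i \<in> p" "j \<in> p" "i \<noteq> j" for i j
        using pD(5)[of "fst i" "snd i" "fst j" "snd j"] that i(1)[of i] i(1)[of j]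
        by (metis interior_atLeastAtMost_real prod.collapse)
      have "(\<Sum>(x, k)\<in>p. measure lborel k *\<^sub>R h x) = (\<Sum>i\<in>p. (t i - s i) * h (fst i))"
        unfolding case_prod_unfold
      proof (rule sum.cong)
        fix j assume "j \<in> p"
        then have "measure lborel (snd j) = t j - s j"
          using i[of j] by (metis content_real order_trans)
        then show "measure lborel (snd j) *\<^sub>R h (fst j) = (t j - s j) * h (fst j)" by simp
      qed simp
      moreover have "g b - g a = (\<Sum>i\<in>p. g (t i) - g (s i))"
        using additive_tagged_division_1[OF ab(2) pI, of g] by (simp add: case_prod_unfold s_def t_def)
      ultimately have "(\<Sum>(x, k)\<in>p. measure lborel k *\<^sub>R h x) - (g b - g a) = (\<Sum>i\<in>p. w i)"
        by (simp add: w_def sum_subtractf)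
      also have "norm \<dots> \<le> (\<Sum>i\<in>p. \<bar>w i\<bar>)"
        by (simp add: sum_abs)
      also have "\<dots> = (\<Sum>i\<in>{i\<in>p. fst i \<in> N}. \<bar>w i\<bar>) + (\<Sum>i\<in>{i\<in>p. fst i \<notin> N}. \<bar>w i\<bar>)"
        using pD(1) by (subst sum.union_disjoint[symmetric]) (auto intro!: sum.cong)
      also have "(\<Sum>i\<in>{i\<in>p. fst i \<notin> N}. \<bar>w i\<bar>) \<le> (\<Sum>i\<in>{i\<in>p. fst i \<notin> N}. \<eta> * (t i - s i))"
      proof (rule sum_mono)
        fix j assume "j \<in> {i\<in>p. fst i \<notin> N}"
        then have j: "j \<in> p" "fst j \<notin> N" by auto
        note ij = i[OF j(1)]
        have "s j \<in> ball (fst j) (\<rho> (fst j))" "t j \<in> ball (fst j) (\<rho> (fst j))"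
          using ij(1,2,3,6) j(2) unfolding \<gamma>_def by force+
        then have "\<bar>g (s j) - g (fst j) - (s j - fst j) * g' (fst j)\<bar> \<le> \<eta> * \<bar>s j - fst j\<bar>"
          "\<bar>g (t j) - g (fst j) - (t j - fst j) * g' (fst j)\<bar> \<le> \<eta> * \<bar>t j - fst j\<bar>"
          using ij j(2) by (intro \<rho>(2); auto simp: dist_real_def)+
        \<comment> \<open>The tag lies inside its cell, so both end points are compared with the
          linear approximation at the tag.\<close>
        moreover have "w j = (g (s j) - g (fst j) - (s j - fst j) * g' (fst j)) - (g (t j) - g (fst j) - (t j - fst j) * g' (fst j))"
          using j(2) by (simp add: w_def h_def algebra_simps)
        moreover have "\<eta> * \<bar>s j - fst j\<bar> + \<eta> * \<bar>t j - fst j\<bar> = \<eta> * (t j - s j)"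
          using ij by (simp add: algebra_simps)
        ultimately show "\<bar>w j\<bar> \<le> \<eta> * (t j - s j)" by linarith
      qed
      also have "\<dots> \<le> (\<Sum>i\<in>p. \<eta> * (t i - s i))"
        using pD(1) \<eta> st by (intro sum_mono2) auto
      also have "\<dots> = \<eta> * (b - a)"
        using additive_tagged_division_1[OF ab(2) pI, of "\<lambda>x. x"]
        by (simp add: case_prod_unfold s_def t_def flip: sum_distrib_left)
      also have "\<dots> \<le> e / 2"
        using e ab by (simp add: \<eta>_def field_simps)
      also have "(\<Sum>i\<in>{i\<in>p. fst i \<in> N}. \<bar>w i\<bar>) < e / 2"
      proof -
        let ?P = "{i\<in>p. fst i \<in> N}"
        have "(\<Sum>i\<in>?P. \<bar>g (t i) - g (s i)\<bar>) < e / 2"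
        proof (rule fam[rule_format])
          show fin: "finite ?P" using pD(1) by simp
          show "c \<le> s j \<and> s j \<le> t j \<and> t j \<le> d" if "j \<in> ?P" for j
            using i[of j] that ab by auto
          show "{s i<..<t i} \<inter> {s j<..<t j} = {}" if "i \<in> ?P" "j \<in> ?P" "i \<noteq> j" for i j
            using disj that by auto
          have "(\<Sum>i\<in>?P. t i - s i) = (\<Sum>i\<in>?P. measure lebesgue {s i<..<t i})"
            using st by (intro sum.cong refl) auto
          also have "\<dots> = measure lebesgue (\<Union>i\<in>?P. {s i<..<t i})"
          proof (rule measure_UNION'[symmetric])
            show "pairwise (\<lambda>i j. disjnt {s i<..<t i} {s j<..<t j}) ?P"
              using disj by (auto simp: pairwise_def disjnt_def)
          qed (use fin in auto)
          also have "\<dots> \<le> measure lebesgue U"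
          proof (rule measure_mono_fmeasurable)
            show "(\<Union>i\<in>?P. {s i<..<t i}) \<subseteq> U"
            proof (rule UN_least)
              fix j assume "j \<in> ?P"
              then have "{s j..t j} \<subseteq> U" using i(1,6)[of j] by (auto simp: \<gamma>_def)
              then show "{s j<..<t j} \<subseteq> U" by (meson greaterThanLessThan_subseteq_atLeastAtMost_iff order_refl order_trans)
            qed
          qed (use U fin in auto)
          finally show "(\<Sum>i\<in>?P. t i - s i) < \<delta>" using U(4) by simp
        qed
        moreover have "\<bar>w i\<bar> = \<bar>g (t i) - g (s i)\<bar>" if "i \<in> ?P" for i
          using that by (simp add: w_def h_def abs_minus_commute)
        ultimately show ?thesis by simp
      qed
      finally show ?thesis by simp
    qed
    then show "\<exists>\<gamma>. gauge \<gamma> \<and> (\<forall>p. p tagged_division_of cbox a b \<and> \<gamma> fine p \<longrightarrow>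
        norm ((\<Sum>(x, k)\<in>p. measure lborel k *\<^sub>R h x) - (g b - g a)) < e)"
      using gauge by (intro exI[of _ \<gamma>] conjI allI impI) (assumption, elim conjE, assumption)
  qed
  then have "(h has_integral (g b - g a)) {a..b}" by simp
  then show ?thesis
    by (rule has_integral_spike[OF N, rotated]) (simp add: h_def)
qed

section \<open>Continuity and products of absolutely continuous functions\<close>

lemma abs_continuous_imp_continuous_on:
  assumes "abs_continuous_on_Icc c d g"
  shows "continuous_on {c..d} g"
  unfolding continuous_on_iff
proof (intro ballI allI impI)
  fix x e :: real assume x: "x \<in> {c..d}" and e: "e > 0"
  obtain \<delta> where \<delta>: "\<delta> > 0"
      and fam: "\<forall>(I :: unit set) s t. finite I \<longrightarrow> (\<forall>i\<in>I. c \<le> s i \<and> s i \<le> t i \<and> t i \<le> d) \<longrightarrow>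
      (\<forall>i\<in>I. \<forall>j\<in>I. i \<noteq> j \<longrightarrow> {s i<..<t i} \<inter> {s j<..<t j} = {}) \<longrightarrow>
      (\<Sum>i\<in>I. t i - s i) < \<delta> \<longrightarrow> (\<Sum>i\<in>I. \<bar>g (t i) - g (s i)\<bar>) < e"
    by (rule abs_continuous_finite_family[OF assms e])
  have "dist (g y) (g x) < e" if "y \<in> {c..d}" "dist y x < \<delta>" for y
    using fam[rule_format, of UNIV "\<lambda>_. min x y" "\<lambda>_. max x y"] that x
    by (cases "x \<le> y") (auto simp: dist_real_def min_def max_def abs_minus_commute)
  then show "\<exists>d'>0. \<forall>y\<in>{c..d}. dist y x < d' \<longrightarrow> dist (g y) (g x) < e"
    using \<delta> by blast
qed

text \<open>The increment of the product splits into \<open>P (b i) * (g (b i) - g (a i))\<close>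
  and \<open>g (a i) * (P (b i) - P (a i))\<close>. The first part is small by absolute continuity
  of \<open>g\<close>, the second by the Lipschitz condition and boundedness of
  \<open>g\<close>.\<close>

lemma abs_continuous_mult_lipschitz:
  assumes ac: "abs_continuous_on_Icc c d g"
    and P: "\<And>x. x \<in> {c..d} \<Longrightarrow> \<bar>P x\<bar> \<le> M" and L: "\<And>x y. x \<in> {c..d} \<Longrightarrow> y \<in> {c..d} \<Longrightarrow> \<bar>P y - P x\<bar> \<le> L * \<bar>y - x\<bar>"
  shows "abs_continuous_on_Icc c d (\<lambda>x. P x * g x)"
  unfolding abs_continuous_on_Icc_def
proof (intro allI impI)
  fix e :: real assume e: "e > 0"
  have "bounded (g ` {c..d})"
    using abs_continuous_imp_continuous_on[OF ac]
    by (intro compact_imp_bounded compact_continuous_image) auto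
  then obtain B where "\<forall>y\<in>g ` {c..d}. norm y \<le> B" unfolding bounded_iff by blast
  then have B: "\<bar>g x\<bar> \<le> \<bar>B\<bar>" if "x \<in> {c..d}" for x using that by (metis abs_ge_self image_eqI order_trans real_norm_def)
  \<comment> \<open>\<open>e1\<close> and \<open>d1\<close> are chosen so that each of the two parts
    contributes at most \<open>e / 2\<close>; the added 1 keeps the denominators positive.\<close>
  define e1 where "e1 = e / (2 * (\<bar>M\<bar> + 1))"
  have e1: "e1 > 0" using e by (simp add: e1_def)
  define d1 where "d1 = e / (2 * (\<bar>B\<bar> * \<bar>L\<bar> + 1))"
  have d1: "d1 > 0" using e by (simp add: d1_def add_nonneg_pos)
  obtain \<delta> where \<delta>: "\<delta> > 0"
      and fam: "\<And>(n::nat) (a::nat \<Rightarrow> real) (b::nat \<Rightarrow> real).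
        (\<forall>i<n. c \<le> a i \<and> a i \<le> b i \<and> b i \<le> d) \<Longrightarrow>
        (\<forall>i<n. \<forall>j<n. i \<noteq> j \<longrightarrow> {a i<..<b i} \<inter> {a j<..<b j} = {}) \<Longrightarrow>
        (\<Sum>i<n. b i - a i) < \<delta> \<Longrightarrow> (\<Sum>i<n. \<bar>g (b i) - g (a i)\<bar>) < e1"
    using ac[unfolded abs_continuous_on_Icc_def, rule_format, OF e1] by blast
  have "(\<Sum>i<n. \<bar>P (b i) * g (b i) - P (a i) * g (a i)\<bar>) < e"
    if ab: "\<forall>i<n. c \<le> a i \<and> a i \<le> b i \<and> b i \<le> d"
      "\<forall>i<n. \<forall>j<n. i \<noteq> j \<longrightarrow> {a i<..<b i} \<inter> {a j<..<b j} = {}"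
      "(\<Sum>i<n. b i - a i) < min \<delta> d1" for n :: nat and a b
  proof -
    have "(\<Sum>i<n. \<bar>P (b i) * g (b i) - P (a i) * g (a i)\<bar>) \<le>
        (\<Sum>i<n. \<bar>M\<bar> * \<bar>g (b i) - g (a i)\<bar> + \<bar>B\<bar> * \<bar>L\<bar> * (b i - a i))"
    proof (rule sum_mono)
      fix i assume "i \<in> {..<n}"
      then have i: "a i \<in> {c..d}" "b i \<in> {c..d}" "a i \<le> b i" using ab(1) by (auto intro: order_trans)
      have "P (b i) * g (b i) - P (a i) * g (a i) = P (b i) * (g (b i) - g (a i)) + g (a i) * (P (b i) - P (a i))"
        by (simp add: algebra_simps)
      then have "\<bar>P (b i) * g (b i) - P (a i) * g (a i)\<bar> \<le> \<bar>P (b i)\<bar> * \<bar>g (b i) - g (a i)\<bar> + \<bar>g (a i)\<bar> * \<bar>P (b i) - P (a i)\<bar>"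
        by (metis abs_mult abs_triangle_ineq)
      also have "\<bar>P (b i)\<bar> * \<bar>g (b i) - g (a i)\<bar> \<le> \<bar>M\<bar> * \<bar>g (b i) - g (a i)\<bar>"
        using P[OF i(2)] by (intro mult_right_mono) auto
      also have "\<bar>g (a i)\<bar> * \<bar>P (b i) - P (a i)\<bar> \<le> \<bar>B\<bar> * (\<bar>L\<bar> * (b i - a i))"
      proof (rule mult_mono)
        have "\<bar>P (b i) - P (a i)\<bar> \<le> L * (b i - a i)" using L[OF i(1,2)] i(3) by simp
        also have "\<dots> \<le> \<bar>L\<bar> * (b i - a i)" using i(3) by (intro mult_right_mono) auto
        finally show "\<bar>P (b i) - P (a i)\<bar> \<le> \<bar>L\<bar> * (b i - a i)" .
      qed (use B[OF i(1)] i(3) in auto)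
      finally show "\<bar>P (b i) * g (b i) - P (a i) * g (a i)\<bar> \<le> \<bar>M\<bar> * \<bar>g (b i) - g (a i)\<bar> + \<bar>B\<bar> * \<bar>L\<bar> * (b i - a i)"
        by simp
    qed
    also have "\<dots> = \<bar>M\<bar> * (\<Sum>i<n. \<bar>g (b i) - g (a i)\<bar>) + \<bar>B\<bar> * \<bar>L\<bar> * (\<Sum>i<n. b i - a i)"
      by (simp add: sum.distrib sum_distrib_left)
    also have "\<bar>M\<bar> * (\<Sum>i<n. \<bar>g (b i) - g (a i)\<bar>) \<le> \<bar>M\<bar> * e1"
      using fam[OF ab(1,2)] ab(3) by (intro mult_left_mono) auto
    also have "\<bar>M\<bar> * e1 < e / 2"
      using e by (simp add: e1_def field_simps)
    also have "\<bar>B\<bar> * \<bar>L\<bar> * (\<Sum>i<n. b i - a i) \<le> \<bar>B\<bar> * \<bar>L\<bar> * d1"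
      using ab(3) by (intro mult_left_mono) auto
    also have "\<dots> \<le> e / 2"
    proof -
      have "\<bar>B\<bar> * \<bar>L\<bar> * d1 = (\<bar>B\<bar> * \<bar>L\<bar> / (\<bar>B\<bar> * \<bar>L\<bar> + 1)) * (e / 2)"
        by (simp add: d1_def)
      also have "\<dots> \<le> 1 * (e / 2)"
        using e by (intro mult_right_mono) (auto simp: divide_le_eq add_nonneg_pos)
      finally show ?thesis by simp
    qed
    finally show ?thesis by simp
  qed
  then show "\<exists>\<delta>>0. \<forall>(n::nat) a b. (\<forall>i<n. c \<le> a i \<and> a i \<le> b i \<and> b i \<le> d) \<and>
        (\<forall>i<n. \<forall>j<n. i \<noteq> j \<longrightarrow> {a i<..<b i} \<inter> {a j<..<b j} = {}) \<and>
        (\<Sum>i<n. b i - a i) < \<delta> \<longrightarrow> (\<Sum>i<n. \<bar>P (b i) * g (b i) - P (a i) * g (a i)\<bar>) < e"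
    using \<delta> d1 by (intro exI[of _ "min \<delta> d1"]) auto
qed

section \<open>Integration by parts and the kernel estimate\<close>

lemma derivI_0 [simp]: "derivI 0 f = f"
  by (simp add: derivI_def)

lemma derivI_Suc: "derivI (Suc j) f x = vector_derivative (derivI j f) (at x within II)"
  by (simp add: derivI_def)

lemma L2r_has_derivative:
  assumes "f \<in> L2r r" "Suc j < r" "x \<in> II"
  shows "(derivI j f has_vector_derivative derivI (Suc j) f x) (at x within II)"
proof -
  have "derivI j f differentiable (at x within II)"
    using assms unfolding L2r_def differentiable_on_def by auto
  then show ?thesis unfolding derivI_Suc by (simp add: vector_derivative_works)
qed

lemma L2r_has_derivative_ae:
  assumes "f \<in> L2r (Suc n)"
  obtains N where "negligible N"
    "\<And>x. x \<in> II - N \<Longrightarrow> (derivI n f has_vector_derivative derivI (Suc n) f x) (at x within II)"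
proof
  \<comment> \<open>The end points join the null set because the differentiability theorem covers
    only the open interval.\<close>
  let ?N = "{x \<in> {-1<..<1}. \<not> derivI n f differentiable (at x)} \<union> {-1, 1}"
  have "abs_continuous_on_Icc (-1) 1 (derivI n f)"
    using assms by (simp add: L2r_def)
  then have "negligible {x \<in> {-1<..<1}. \<not> derivI n f differentiable (at x)}"
    by (rule abs_continuous_differentiable_ae)
  then show "negligible ?N"
    by (rule negligible_Un) simp
  fix x assume "x \<in> II - ?N"
  then have "derivI n f differentiable (at x)"
    by auto
  then have "derivI n f differentiable (at x within II)"
    by (rule differentiable_at_withinI)
  then show "(derivI n f has_vector_derivative derivI (Suc n) f x) (at x within II)"
    unfolding derivI_Suc by (simp add: vector_derivative_works)
qed

lemma L2r_continuous_on:
  assumes "f \<in> L2r r" "j < r"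
  shows "continuous_on II (derivI j f)"
proof (cases "Suc j < r")
  case True
  then show ?thesis
    unfolding continuous_on_eq_continuous_within
    using L2r_has_derivative[OF assms(1)] has_vector_derivative_continuous by blast
next
  case False
  then have "j = r - 1" using assms by simp
  then show ?thesis
    using assms abs_continuous_imp_continuous_on by (auto simp: L2r_def)
qed

lemma poly_has_vector_derivative:
  "(poly p has_vector_derivative poly (pderiv p) x) (at x within (S :: real set))"
  using poly_DERIV[of p x] has_real_derivative_iff_has_vector_derivative
    has_field_derivative_at_within by blast

lemma poly_lipschitz_on_II:
  fixes p :: "real poly"
  obtains M L where "\<And>x. x \<in> II \<Longrightarrow> \<bar>poly p x\<bar> \<le> M"
    "\<And>x y. x \<in> II \<Longrightarrow> y \<in> II \<Longrightarrow> \<bar>poly p y - poly p x\<bar> \<le> L * \<bar>y - x\<bar>"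
proof -
  have bd: "\<exists>M. \<forall>x\<in>II. \<bar>poly q x\<bar> \<le> M" for q :: "real poly"
  proof -
    have "bounded (poly q ` II)"
      by (intro compact_imp_bounded compact_continuous_image) (auto intro!: continuous_intros)
    then show ?thesis unfolding bounded_iff by auto
  qed
  obtain M where M: "\<forall>x\<in>II. \<bar>poly p x\<bar> \<le> M" using bd by blast
  obtain L where L: "\<forall>x\<in>II. \<bar>poly (pderiv p) x\<bar> \<le> L" using bd by blast
  have "\<bar>poly p y - poly p x\<bar> \<le> L * \<bar>y - x\<bar>" if "x \<in> II" "y \<in> II" for x y
  proof -
    have "norm (poly p y - poly p x) \<le> L * norm (y - x)"
    proof (rule field_differentiable_bound[of II])
      show "(poly p has_field_derivative poly (pderiv p) z) (at z within II)" for z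
        using poly_DERIV has_field_derivative_at_within by blast
    qed (use L that in auto)
    then show ?thesis by simp
  qed
  with M show thesis using that by blast
qed

text \<open>Below the top order the product is differentiable everywhere and the classical
  fundamental theorem applies. For \<open>j = r - 1\<close> the derivative may exist only almost
  everywhere, and absolute continuity of the product is used instead.\<close>

lemma integration_by_parts_step:
  assumes f: "f \<in> L2r r" and j: "j < r" and cd: "-1 \<le> c" "c \<le> d" "d \<le> 1"
  shows "((\<lambda>t. poly p t * derivI (Suc j) f t + poly (pderiv p) t * derivI j f t) has_integral
    poly p d * derivI j f d - poly p c * derivI j f c) {c..d}"
proof -
  have sub: "{c..d} \<subseteq> II" using cd by auto
  have der: "((\<lambda>t. poly p t * derivI j f t) has_vector_derivative
      poly p x * derivI (Suc j) f x + poly (pderiv p) x * derivI j f x) (at x within {c..d})"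
    if "(derivI j f has_vector_derivative derivI (Suc j) f x) (at x within II)" for x
    using has_vector_derivative_mult[OF poly_has_vector_derivative[of p x]
        has_vector_derivative_within_subset[OF that sub]] .
  show ?thesis
  proof (cases "Suc j < r")
    case True
    show ?thesis
      by (rule fundamental_theorem_of_calculus[OF cd(2)], rule der, rule L2r_has_derivative[OF f True])
        (use sub in auto)
  next
    case False
    then have r: "r = Suc j" using j by simp
    obtain N where N: "negligible N"
      "\<And>x. x \<in> II - N \<Longrightarrow> (derivI j f has_vector_derivative derivI (Suc j) f x) (at x within II)"
      using L2r_has_derivative_ae f r by blast
    obtain M L where "\<And>x. x \<in> II \<Longrightarrow> \<bar>poly p x\<bar> \<le> M"
      "\<And>x y. x \<in> II \<Longrightarrow> y \<in> II \<Longrightarrow> \<bar>poly p y - poly p x\<bar> \<le> L * \<bar>y - x\<bar>"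
      using poly_lipschitz_on_II by blast
    moreover have "abs_continuous_on_Icc (-1) 1 (derivI j f)"
      using f r by (simp add: L2r_def)
    ultimately have "abs_continuous_on_Icc (-1) 1 (\<lambda>t. poly p t * derivI j f t)"
      by (intro abs_continuous_mult_lipschitz)
    then show ?thesis
      by (rule abs_continuous_FTC[OF _ cd N(1)], intro der N(2)) (use sub in auto)
  qed
qed

text \<open>The boundary terms produced by moving \<open>r\<close> derivatives from \<open>f\<close>
  to \<open>p\<close>.\<close>

definition boundary_form :: "nat \<Rightarrow> real poly \<Rightarrow> (real \<Rightarrow> real) \<Rightarrow> real \<Rightarrow> real" where
  "boundary_form r p f t = (\<Sum>s<r. (-1) ^ s * poly ((pderiv ^^ s) p) t * derivI (r - 1 - s) f t)"

text \<open>The alternating sum of the single steps telescopes: only the term with all derivatives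
  on \<open>f\<close> and the one with all derivatives on \<open>p\<close> survive.\<close>

lemma integration_by_parts:
  assumes f: "f \<in> L2r r" and cd: "-1 \<le> c" "c \<le> d" "d \<le> 1"
  shows "((\<lambda>t. poly p t * derivI r f t - (-1) ^ r * poly ((pderiv ^^ r) p) t * f t) has_integral
    boundary_form r p f d - boundary_form r p f c) {c..d}"
proof -
  define T where "T = (\<lambda>t s. (-1) ^ s * poly ((pderiv ^^ s) p) t * derivI (r - s) f t)"
  have "((\<lambda>t. \<Sum>s<r. (-1) ^ s * (poly ((pderiv ^^ s) p) t * derivI (Suc (r - 1 - s)) f t +
        poly (pderiv ((pderiv ^^ s) p)) t * derivI (r - 1 - s) f t)) has_integral
      (\<Sum>s<r. (-1) ^ s * (poly ((pderiv ^^ s) p) d * derivI (r - 1 - s) f d -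
        poly ((pderiv ^^ s) p) c * derivI (r - 1 - s) f c))) {c..d}"
    by (intro has_integral_sum has_integral_mult_right integration_by_parts_step[OF f _ cd]) auto
  moreover have "(\<Sum>s<r. (-1) ^ s * (poly ((pderiv ^^ s) p) t * derivI (Suc (r - 1 - s)) f t +
        poly (pderiv ((pderiv ^^ s) p)) t * derivI (r - 1 - s) f t)) =
      poly p t * derivI r f t - (-1) ^ r * poly ((pderiv ^^ r) p) t * f t" for t
  proof -
    have "(\<Sum>s<r. (-1) ^ s * (poly ((pderiv ^^ s) p) t * derivI (Suc (r - 1 - s)) f t +
        poly (pderiv ((pderiv ^^ s) p)) t * derivI (r - 1 - s) f t)) = (\<Sum>s<r. T t s - T t (Suc s))"
    proof (rule sum.cong)
      fix s assume "s \<in> {..<r}"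
      then have "Suc (r - 1 - s) = r - s" "r - 1 - s = r - Suc s" by auto
      then show "(-1) ^ s * (poly ((pderiv ^^ s) p) t * derivI (Suc (r - 1 - s)) f t +
        poly (pderiv ((pderiv ^^ s) p)) t * derivI (r - 1 - s) f t) = T t s - T t (Suc s)"
        by (simp add: T_def algebra_simps)
    qed simp
    also have "\<dots> = T t 0 - T t r" by (rule sum_lessThan_telescope')
    finally show ?thesis by (simp add: T_def)
  qed
  moreover have "(\<Sum>s<r. (-1) ^ s * (poly ((pderiv ^^ s) p) d * derivI (r - 1 - s) f d -
        poly ((pderiv ^^ s) p) c * derivI (r - 1 - s) f c)) = boundary_form r p f d - boundary_form r p f c"
    unfolding boundary_form_def sum_subtractf[symmetric] by (intro sum.cong) (auto simp: algebra_simps)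
  ultimately show ?thesis by simp
qed

section \<open>Square-integrable functions and the Cauchy-Schwarz inequality\<close>

lemma L2_bounded_measurable:
  assumes "u \<in> borel_measurable (lebesgue_on II)" "\<And>x. x \<in> II \<Longrightarrow> \<bar>u x\<bar> \<le> M"
  shows "u \<in> L2"
proof -
  have "integrable (lebesgue_on II) (\<lambda>x. \<bar>u x\<bar>\<^sup>2)"
  proof (rule finite_measure.integrable_const_bound[where B = "M\<^sup>2"])
    show "finite_measure (lebesgue_on II)"
      by (rule finite_measure_lebesgue_on) auto
    have "\<bar>u x\<bar>\<^sup>2 \<le> M\<^sup>2" if "x \<in> II" for x
      using assms(2)[OF that] by (intro power_mono) auto
    then show "AE x in lebesgue_on II. norm (\<bar>u x\<bar>\<^sup>2) \<le> M\<^sup>2"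
      by (intro AE_I2) (simp add: space_restrict_space)
  qed (use assms(1) in measurable)
  then show ?thesis using assms(1) by (simp add: L2_def)
qed

lemma L2_continuous:
  assumes "continuous_on II u"
  shows "u \<in> L2"
proof -
  have "bounded (u ` II)"
    using assms by (intro compact_imp_bounded compact_continuous_image) auto
  then obtain M where "\<forall>y\<in>u ` II. norm y \<le> M" unfolding bounded_iff by blast
  then show ?thesis
    using assms by (intro L2_bounded_measurable[where M = M] continuous_imp_measurable_on_sets_lebesgue) auto
qed

lemma L2_poly: "poly p \<in> L2"
  by (intro L2_continuous continuous_intros)

lemma L2_piecewise_poly: "(\<lambda>t. if t \<le> x then poly p t else poly q t) \<in> L2"
proof -
  obtain M L where M: "\<And>x. x \<in> II \<Longrightarrow> \<bar>poly p x\<bar> \<le> M"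
    by (rule poly_lipschitz_on_II[of p]) blast
  obtain M' L where M': "\<And>x. x \<in> II \<Longrightarrow> \<bar>poly q x\<bar> \<le> M'"
    by (rule poly_lipschitz_on_II[of q]) blast
  have [measurable]: "poly p \<in> borel_measurable borel" for p :: "real poly"
    by (intro borel_measurable_continuous_onI continuous_intros)
  have "(\<lambda>t. if t \<le> x then poly p t else poly q t) \<in> borel_measurable borel"
    by measurable
  then have "(\<lambda>t. if t \<le> x then poly p t else poly q t) \<in> borel_measurable (lebesgue_on II)"
    by (intro measurable_restrict_space1) (rule measurable_completion, simp)
  then show ?thesis
    using M M' by (rule_tac L2_bounded_measurable[where M = "max M M'"]) (auto simp: le_max_iff_disj)
qed

lemma norm2_sq: "(norm2 u)\<^sup>2 = (LINT x|lebesgue_on II. (u x)\<^sup>2)"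
  by (simp add: norm2_def integral_nonneg_AE)

lemma norm2_nonneg: "0 \<le> norm2 u"
  by (simp add: norm2_def integral_nonneg_AE)

lemma L2_sq_integrable: "u \<in> L2 \<Longrightarrow> integrable (lebesgue_on II) (\<lambda>x. (u x)\<^sup>2)"
  by (simp add: L2_def)

lemma norm2_sq_integral:
  assumes "u \<in> L2"
  shows "(norm2 u)\<^sup>2 = integral II (\<lambda>x. (u x)\<^sup>2)"
  unfolding norm2_sq by (rule lebesgue_integral_eq_integral[OF L2_sq_integrable[OF assms]]) simp

lemma L2_mult_integrable:
  assumes "u \<in> L2" "v \<in> L2"
  shows "integrable (lebesgue_on II) (\<lambda>x. u x * v x)"
proof (rule Bochner_Integration.integrable_bound)
  show "integrable (lebesgue_on II) (\<lambda>x. (u x)\<^sup>2 + (v x)\<^sup>2)"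
    using assms by (intro Bochner_Integration.integrable_add L2_sq_integrable)
  show "(\<lambda>x. u x * v x) \<in> borel_measurable (lebesgue_on II)"
    using assms by (intro borel_measurable_times) (simp_all add: L2_def)
  have "\<bar>a * b\<bar> \<le> a\<^sup>2 + b\<^sup>2" for a b :: real
  proof -
    have "0 \<le> (\<bar>a\<bar> - \<bar>b\<bar>)\<^sup>2" by simp
    also have "\<dots> = a\<^sup>2 + b\<^sup>2 - 2 * \<bar>a * b\<bar>"
      by (simp add: power2_eq_square algebra_simps abs_mult)
    finally show ?thesis using abs_ge_zero[of "a * b"] by linarith
  qed
  then show "AE x in lebesgue_on II. norm (u x * v x) \<le> norm ((u x)\<^sup>2 + (v x)\<^sup>2)"
    by simp
qed

text \<open>The squared norm of \<open>u - l * v\<close> is a nonnegative quadratic function of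
  \<open>l\<close>; a suitable \<open>l\<close> gives the inequality.\<close>

lemma L2_Cauchy_Schwarz:
  assumes u: "u \<in> L2" and v: "v \<in> L2"
  shows "\<bar>LINT x|lebesgue_on II. u x * v x\<bar> \<le> norm2 u * norm2 v"
proof -
  define A where "A = (LINT x|lebesgue_on II. (u x)\<^sup>2)"
  define B where "B = (LINT x|lebesgue_on II. u x * v x)"
  define C where "C = (LINT x|lebesgue_on II. (v x)\<^sup>2)"
  have nn: "0 \<le> A - 2 * l * B + l\<^sup>2 * C" for l
  proof -
    have "0 \<le> (LINT x|lebesgue_on II. (u x - l * v x)\<^sup>2)"
      by (simp add: integral_nonneg_AE)
    also have "\<dots> = (LINT x|lebesgue_on II. (u x)\<^sup>2 - 2 * l * (u x * v x) + l\<^sup>2 * (v x)\<^sup>2)"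
      by (intro Bochner_Integration.integral_cong) (auto simp: power2_eq_square algebra_simps)
    also have "\<dots> = A - 2 * l * B + l\<^sup>2 * C"
      using L2_sq_integrable[OF u] L2_sq_integrable[OF v] L2_mult_integrable[OF u v]
      by (simp add: A_def B_def C_def)
    finally show ?thesis .
  qed
  have "C \<ge> 0" by (simp add: C_def integral_nonneg_AE)
  have "B\<^sup>2 \<le> A * C"
  proof (cases "C = 0")
    case True
    have "B = 0"
    proof (rule ccontr)
      assume "B \<noteq> 0"
      \<comment> \<open>At this \<open>l\<close> the expression \<open>A - 2 * l * B\<close> equals
        -1.\<close>
      then show False using nn[of "(A + 1) / (2 * B)"] True by (simp add: field_simps)
    qed
    then show ?thesis using True by simp
  next
    case False
    \<comment> \<open>\<open>l = B / C\<close> minimizes the quadratic.\<close>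
    have "A - 2 * (B / C) * B + (B / C)\<^sup>2 * C = A - B\<^sup>2 / C"
      using False by (simp add: power2_eq_square)
    then have "B\<^sup>2 / C \<le> A"
      using nn[of "B / C"] by simp
    then show ?thesis using False \<open>C \<ge> 0\<close> by (simp add: divide_le_eq split: if_splits)
  qed
  also have "A * C = (norm2 u * norm2 v)\<^sup>2"
    by (simp add: power_mult_distrib norm2_sq A_def C_def)
  finally have "\<bar>B\<bar>\<^sup>2 \<le> (norm2 u * norm2 v)\<^sup>2" by simp
  then show ?thesis
    unfolding B_def by (rule power2_le_imp_le) (simp add: norm2_nonneg)
qed

section \<open>Boundary terms and the kernel estimate\<close>

lemma boundary_form_zero:
  assumes "\<And>s. s < r \<Longrightarrow> poly ((pderiv ^^ s) p) t = 0"
  shows "boundary_form r p f t = 0"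
  using assms by (simp add: boundary_form_def)

lemma boundary_form_diff:
  "boundary_form r (p - q) f t = boundary_form r p f t - boundary_form r q f t"
proof -
  have "(pderiv ^^ s) (p - q) = (pderiv ^^ s) p - (pderiv ^^ s) q" for s
    by (induction s) (auto simp: pderiv_diff)
  then show ?thesis
    unfolding boundary_form_def sum_subtractf[symmetric] 
    by (intro sum.cong) (simp_all add: left_diff_distrib right_diff_distrib)
qed

lemma boundary_form_single:
  assumes "m < r" "\<And>s. s < r \<Longrightarrow> poly ((pderiv ^^ s) p) t = (if s = m then c else 0)"
  shows "boundary_form r p f t = (-1) ^ m * c * derivI (r - 1 - m) f t"
proof -
  have "boundary_form r p f t = (\<Sum>s<r. if s = m then (-1) ^ m * c * derivI (r - 1 - m) f t else 0)"
    unfolding boundary_form_def using assms(2) by (intro sum.cong) auto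
  then show ?thesis using assms(1) by simp
qed

text \<open>Integrate by parts on each side of \<open>x\<close>. The boundary forms at -1 and 1
  vanish, and the two at \<open>x\<close> combine to that of \<open>p - q\<close>, where one
  surviving derivative isolates the derivative of \<open>f\<close> of order
  \<open>r - 1 - m\<close>. Cauchy-Schwarz bounds the integrals.\<close>

lemma derivative_kernel_estimate:
  assumes f: "f \<in> L2r r" and x: "-1 \<le> x" "x \<le> 1" and m: "m < r"
    and p: "\<And>s. s < r \<Longrightarrow> poly ((pderiv ^^ s) p) (-1) = 0"
    and q: "\<And>s. s < r \<Longrightarrow> poly ((pderiv ^^ s) q) 1 = 0"
    and pq: "(pderiv ^^ r) p = (pderiv ^^ r) q"
    and jump: "\<And>s. s < r \<Longrightarrow> poly ((pderiv ^^ s) (p - q)) x = (if s = m then c else 0)" and c: "\<bar>c\<bar> = 1"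
  shows "\<bar>derivI (r - 1 - m) f x\<bar> \<le> norm2 (poly ((pderiv ^^ r) p)) * norm2 f +
    norm2 (\<lambda>t. if t \<le> x then poly p t else poly q t) * norm2 (derivI r f)"
proof -
  define g where "g = (\<lambda>t. if t \<le> x then poly p t else poly q t)"
  define w where "w = poly ((pderiv ^^ r) p)"
  have g: "g \<in> L2" unfolding g_def by (rule L2_piecewise_poly)
  have w: "w \<in> L2" unfolding w_def by (rule L2_poly)
  have f0: "f \<in> L2"
    using L2_continuous[OF L2r_continuous_on[OF f, of 0]] m by simp
  have fr: "derivI r f \<in> L2" using f by (simp add: L2r_def)
  have "((\<lambda>t. g t * derivI r f t - (-1) ^ r * (w t * f t)) has_integral
      boundary_form r p f x - boundary_form r p f (-1)) {-1..x}"
    by (rule has_integral_eq[OF _ integration_by_parts[OF f _ x(1) x(2), of p]]) (auto simp: g_def w_def)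
  \<comment> \<open>On \<open>{x..1}\<close> the glued kernel takes the value of \<open>p\<close> at
    \<open>x\<close> itself, a single point, which the integral ignores.\<close>
  moreover have "((\<lambda>t. g t * derivI r f t - (-1) ^ r * (w t * f t)) has_integral
      boundary_form r q f 1 - boundary_form r q f x) {x..1}"
    by (rule has_integral_spike_finite[OF _ _ integration_by_parts[OF f x(1) x(2), of q], of "{x}"])
      (auto simp: g_def w_def pq)
  ultimately have "((\<lambda>t. g t * derivI r f t - (-1) ^ r * (w t * f t)) has_integral
      (boundary_form r p f x - boundary_form r p f (-1)) + (boundary_form r q f 1 - boundary_form r q f x)) {-1..1}"
    by (rule has_integral_combine[OF x])
  moreover have "boundary_form r p f (-1) = 0" "boundary_form r q f 1 = 0"
    using p q by (intro boundary_form_zero; simp)+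
  moreover have "boundary_form r p f x - boundary_form r q f x = (-1) ^ m * c * derivI (r - 1 - m) f x"
    using boundary_form_single[OF m jump] by (simp add: boundary_form_diff)
  ultimately have "((\<lambda>t. g t * derivI r f t - (-1) ^ r * (w t * f t)) has_integral
      (-1) ^ m * c * derivI (r - 1 - m) f x) II"
    by (simp add: add_diff_eq diff_add_eq)
  moreover have int: "integrable (lebesgue_on II) (\<lambda>t. g t * derivI r f t)"
    "integrable (lebesgue_on II) (\<lambda>t. w t * f t)"
    by (intro L2_mult_integrable g w f0 fr)+
  ultimately have "(-1) ^ m * c * derivI (r - 1 - m) f x =
      (LINT t|lebesgue_on II. g t * derivI r f t - (-1) ^ r * (w t * f t))"
    by (subst lebesgue_integral_eq_integral) (auto simp: integral_unique)
  also have "\<dots> = (LINT t|lebesgue_on II. g t * derivI r f t) - (-1) ^ r * (LINT t|lebesgue_on II. w t * f t)"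
    using int by simp
  finally have "\<bar>derivI (r - 1 - m) f x\<bar> =
      \<bar>(LINT t|lebesgue_on II. g t * derivI r f t) - (-1) ^ r * (LINT t|lebesgue_on II. w t * f t)\<bar>"
    using c by (metis abs_mult abs_power_minus abs_1 power_one mult_1)
  also have "\<dots> \<le> \<bar>LINT t|lebesgue_on II. g t * derivI r f t\<bar> + \<bar>LINT t|lebesgue_on II. w t * f t\<bar>"
    by (rule order_trans[OF abs_triangle_ineq4]) (simp add: abs_mult)
  also have "\<dots> \<le> norm2 g * norm2 (derivI r f) + norm2 w * norm2 f"
    by (intro add_mono L2_Cauchy_Schwarz g w f0 fr)
  finally show ?thesis by (simp add: g_def w_def add.commute)
qed

section \<open>The Hermite interpolants\<close>

lemma pderiv_sum: "pderiv (sum f A) = (\<Sum>x\<in>A. pderiv (f x))"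
  by (induction A rule: infinite_finite_induct) (auto simp: pderiv_add)

lemma poly_antiderivative:
  fixes p :: "real poly"
  obtains P where "pderiv P = p" "poly P c = 0"
proof -
  define Q where "Q = (\<Sum>i\<le>degree p. monom (coeff p i / real (Suc i)) (Suc i))"
  have "pderiv Q = (\<Sum>i\<le>degree p. monom (coeff p i) i)"
    unfolding Q_def pderiv_sum by (intro sum.cong refl) (simp add: pderiv_monom del: of_nat_Suc)
  then have "pderiv Q = p" by (simp add: poly_as_sum_of_monoms)
  then have "pderiv (Q - [:poly Q c:]) = p" by (simp add: pderiv_diff pderiv_pCons)
  then show thesis by (rule that) simp
qed

lemma higher_pderiv_vanish_Suc:
  fixes p :: "real poly"
  assumes "poly p c = 0" "\<And>s. s < n \<Longrightarrow> poly ((pderiv ^^ s) (pderiv p)) c = 0" "s < Suc n"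
  shows "poly ((pderiv ^^ s) p) c = 0"
  using assms by (cases s) (auto simp: funpow_swap1)

lemma higher_pderiv_vanish_smult:
  fixes p :: "real poly"
  assumes "[:- c, 1:] ^ n dvd p" "s < n"
  shows "poly ((pderiv ^^ s) (smult k p)) c = 0"
  using assms higher_pderiv_zero_iff_dvd[of n p c] by (simp add: higher_pderiv_smult)

text \<open>The condition \<open>third_derivative\<close> says that the squared norm of the kernel \<open>a + x b\<close> (right
  of \<open>x\<close>), \<open>a + x b + t - x\<close> (left of \<open>x\<close>) has a nonnegative third derivative in \<open>x\<close>.\<close>

locale kernel_pair =
  fixes r :: nat and a b :: "real poly"
  assumes r: "r \<ge> 3"
    and degree_a: "degree a \<le> 2 * r - 1" and degree_b: "degree b \<le> 2 * r - 1"
    and b_right: "\<And>s. s < r \<Longrightarrow> poly ((pderiv ^^ s) b) 1 = 0"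
    and b_left: "\<And>s. s < r \<Longrightarrow> poly ((pderiv ^^ s) (b - 1)) (-1) = 0"
    and a_right: "\<And>s. s < r \<Longrightarrow> poly ((pderiv ^^ s) a) 1 = 0"
    and a_left: "\<And>s. s < r \<Longrightarrow> poly ((pderiv ^^ s) (a + [:0, 1:])) (-1) = 0"
    and b_reflect: "\<And>t. poly b (- t) = 1 - poly b t"
    and a_reflect: "\<And>t. poly a (- t) = poly a t + t"
    and b_le_half: "\<And>t. 0 \<le> t \<Longrightarrow> t \<le> 1 \<Longrightarrow> poly b t \<le> 1 / 2"
    and a_le: "\<And>t. 0 \<le> t \<Longrightarrow> t \<le> 1 \<Longrightarrow> poly a t \<le> (1 - t) / 4"
    and third_derivative: "\<And>t. 0 \<le> t \<Longrightarrow> t \<le> 1 \<Longrightarrow>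
      0 \<le> 1 - poly (pderiv a) t - 3 * poly b t - t * poly (pderiv b) t"

text \<open>With \<open>n = r - 2\<close>, let \<open>M\<close> be an antiderivative of a negative
  multiple of \<open>(1 - t^2)^n\<close>, falling from 1 to 0. The polynomials are built so that
  \<open>b'\<close> is a multiple of \<open>(1 - t^2)^(n + 1)\<close> and \<open>a' = - M\<close>;
  this gives the contact of order \<open>r\<close> at both ends. Symmetry and size estimates follow
  from those of \<open>M\<close>.\<close>

lemma kernel_pair_exists:
  assumes "r \<ge> 3"
  obtains a b where "kernel_pair r a b"
proof -
  define n where "n = r - 2"
  have rn: "r = Suc (Suc n)" "n \<ge> 1" using assms by (auto simp: n_def)
  define W :: "real poly" where "W = [:1, 0, -1:]"
  have W: "poly W t = 1 - t\<^sup>2" for t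
    by (simp add: W_def power2_eq_square)
  obtain P where P: "pderiv P = W ^ n" "poly P 0 = 0" by (rule poly_antiderivative)
  have dP: "(poly P has_real_derivative (1 - t\<^sup>2) ^ n) (at t)" for t
    using poly_DERIV[of P t] by (simp add: P(1) W)
  have P_odd: "poly P (- t) = - poly P t" for t
  proof -
    have "((\<lambda>t. poly P t + poly P (- t)) has_real_derivative 0) (at t)" for t
      by (auto intro!: derivative_eq_intros simp: P(1) W)
    then have "poly P t + poly P (- t) = poly P 0 + poly P (- 0)"
      using DERIV_isconst_all by blast
    then show ?thesis using P(2) by simp
  qed
  have P1: "poly P 1 > 0"
  proof -
    have "poly P 0 < poly P 1"
    proof (rule DERIV_pos_imp_increasing_open[of 0 1 "poly P"])
      fix x :: real assume "0 < x" "x < 1"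
      then have "(1 - x\<^sup>2) ^ n > 0" by (intro zero_less_power) (simp add: power_less_one_iff abs_square_less_1)
      then show "\<exists>y. (poly P has_real_derivative y) (at x) \<and> 0 < y" using dP by blast
    qed (auto intro!: continuous_intros)
    then show ?thesis using P(2) by simp
  qed
  \<comment> \<open>This factor makes \<open>M\<close> drop from 1 at -1 to 0 at 1.\<close>
  define C where "C = 1 / (2 * poly P 1)"
  \<comment> \<open>For this value the terms with \<open>W ^ n\<close> cancel in
    \<open>pderiv a\<close> and \<open>pderiv b\<close>, leaving \<open>- M\<close> and a multiple
    of \<open>W ^ Suc n\<close>.\<close>
  define \<kappa> where "\<kappa> = C / (2 * (real n + 1))"
  have C: "C > 0" using P1 by (simp add: C_def)
  have \<kappa>: "\<kappa> > 0" "C = 2 * (real n + 1) * \<kappa>" using C by (simp_all add: \<kappa>_def)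
  define M where "M = [:1/2:] - smult C P"
  define b where "b = M - smult \<kappa> ([:0, 1:] * W ^ Suc n)"
  define a where "a = smult \<kappa> (W ^ Suc n) - [:0, 1:] * M"
  have dM: "pderiv M = smult (- C) (W ^ n)"
    by (simp add: M_def pderiv_diff pderiv_smult P(1) pderiv_pCons)
  have "pderiv W = [:0, -2:]" by (simp add: W_def pderiv_pCons)
  then have dW: "pderiv (W ^ Suc n) = smult (of_nat (Suc n)) (W ^ n) * [:0, -2:]"
    by (simp only: pderiv_power_Suc)
  have db: "pderiv b = smult (- ((2 * real n + 3) * \<kappa>)) (W ^ Suc n)"
  proof -
    have "poly (pderiv b) t = poly (smult (- ((2 * real n + 3) * \<kappa>)) (W ^ Suc n)) t" for t
      unfolding b_def pderiv_diff pderiv_smult pderiv_mult dW dM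
      by (simp add: pderiv_pCons W \<kappa>(2) del: power_Suc) (simp add: algebra_simps power2_eq_square)
    then show ?thesis by (simp add: poly_eq_poly_eq_iff[symmetric] fun_eq_iff del: poly_eq_poly_eq_iff)
  qed
  have da: "pderiv a = - M"
  proof -
    have "poly (pderiv a) t = poly (- M) t" for t
      unfolding a_def pderiv_diff pderiv_smult pderiv_mult dW dM
      by (simp add: pderiv_pCons W \<kappa>(2) del: power_Suc) (simp add: algebra_simps)
    then show ?thesis by (simp add: poly_eq_poly_eq_iff[symmetric] fun_eq_iff del: poly_eq_poly_eq_iff)
  qed
  have M: "poly M t = 1/2 - C * poly P t" for t by (simp add: M_def)
  have M_val: "poly M 1 = 0" "poly M 0 = 1/2" "poly M (-1) = 1"
    using P1 P(2) P_odd[of 1] by (simp_all add: M C_def)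
  have M_reflect: "poly M (- t) = 1 - poly M t" for t by (simp add: M P_odd)
  have bv: "poly b t = poly M t - \<kappa> * t * (1 - t\<^sup>2) ^ Suc n" for t
    by (simp add: b_def W del: power_Suc)
  have av: "poly a t = \<kappa> * (1 - t\<^sup>2) ^ Suc n - t * poly M t" for t
    by (simp add: a_def W del: power_Suc)
  have dvd: "[:- 1, 1:] ^ m dvd W ^ m" "[:- (-1), 1:] ^ m dvd W ^ m" for m
    unfolding W_def by (intro dvd_power_same poly_eq_0_iff_dvd[THEN iffD1], simp)+
  have Wnn: "(1 - t\<^sup>2) ^ m \<ge> 0" if "\<bar>t\<bar> \<le> 1" for m and t :: real
    using that by (intro zero_le_power) (simp add: abs_square_le_1)
  have M_le: "poly M t \<le> (1 - t) / 2" if t: "0 \<le> t" "t \<le> 1" for t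
  proof -
    \<comment> \<open>The derivative of \<open>M\<close> increases on \<open>{0..1}\<close>, so
      \<open>M\<close> lies below the chord from \<open>1/2\<close> at 0 to 0 at 1.\<close>
    have "convex_on {0..1} (poly M)"
    proof (rule convex_on_realI)
      show "(poly M has_real_derivative - C * (1 - x\<^sup>2) ^ n) (at x)" for x
        using poly_DERIV[of M x] by (simp add: dM W)
      show "- C * (1 - x\<^sup>2) ^ n \<le> - C * (1 - y\<^sup>2) ^ n" if "x \<in> {0..1}" "y \<in> {0..1}" "x \<le> y" for x y
      proof -
        have "(1 - y\<^sup>2) ^ n \<le> (1 - x\<^sup>2) ^ n"
          using that by (intro power_mono) (auto simp: power_le_one intro: power_mono)
        then show ?thesis using C by simp
      qed
    qed auto
    from convex_onD[OF this, of t 0 1] t show ?thesis by (simp add: M_val)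
  qed
  have "kernel_pair r a b"
  proof
    show "r \<ge> 3" by fact
    have dP': "degree P \<le> Suc (2 * n)"
    proof -
      have "degree (pderiv P) = 2 * n" by (simp add: P(1) W_def degree_power_eq)
      then show ?thesis by (simp add: degree_pderiv)
    qed
    have dM': "degree M \<le> Suc (2 * n)"
      unfolding M_def by (intro degree_diff_le) (use dP' in auto)
    have dW': "degree (W ^ Suc n) = 2 * n + 2" by (simp add: W_def degree_power_eq del: power_Suc)
    have XM: "degree ([:0, 1:] * q) \<le> Suc (degree q)" for q :: "real poly"
      using degree_mult_le[of "[:0, 1:]" q] by simp
    show "degree a \<le> 2 * r - 1"
      unfolding a_def using XM[of M] dM' dW' rn
      by (intro degree_diff_le order_trans[OF degree_smult_le]) (auto simp del: power_Suc)
    show "degree b \<le> 2 * r - 1"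
      unfolding b_def using XM[of "W ^ Suc n"] dM' dW' rn
      by (intro degree_diff_le order_trans[OF degree_smult_le]) (auto simp del: power_Suc mult_pCons_left)
    \<comment> \<open>\<open>M\<close> has contact of order \<open>Suc n\<close> with its end
      values, one less than \<open>r\<close>; passing to \<open>a\<close>, whose derivative is
      \<open>- M\<close>, supplies the missing order.\<close>
    have M_right: "poly ((pderiv ^^ s) M) 1 = 0" if "s < Suc n" for s
      by (rule higher_pderiv_vanish_Suc[OF M_val(1) _ that], unfold dM,
          rule higher_pderiv_vanish_smult[OF dvd(1)])
    have M_left: "poly ((pderiv ^^ s) (1 - M)) (-1) = 0" if "s < Suc n" for s
    proof (rule higher_pderiv_vanish_Suc[OF _ _ that])
      have "pderiv (1 - M) = smult C (W ^ n)" by (simp add: pderiv_diff dM)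
      then show "poly ((pderiv ^^ s) (pderiv (1 - M))) (-1) = 0" if "s < n" for s
        using higher_pderiv_vanish_smult[OF dvd(2) that] by simp
    qed (simp add: M_val)
    fix s assume "s < r"
    then have s: "s < Suc (Suc n)" using rn by simp
    show "poly ((pderiv ^^ s) b) 1 = 0"
      by (rule higher_pderiv_vanish_Suc[OF _ _ s], simp add: bv M_val, unfold db,
          rule higher_pderiv_vanish_smult[OF dvd(1)])
    show "poly ((pderiv ^^ s) (b - 1)) (-1) = 0"
    proof (rule higher_pderiv_vanish_Suc[OF _ _ s])
      have eq: "pderiv (b - 1) = pderiv b" by (simp add: pderiv_diff)
      show "poly ((pderiv ^^ s) (pderiv (b - 1))) (-1) = 0" if "s < Suc n" for s
        unfolding eq db by (rule higher_pderiv_vanish_smult[OF dvd(2) that])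
    qed (simp add: bv M_val)
    show "poly ((pderiv ^^ s) a) 1 = 0"
    proof (rule higher_pderiv_vanish_Suc[OF _ _ s])
      show "poly ((pderiv ^^ s) (pderiv a)) 1 = 0" if "s < Suc n" for s
        using M_right[OF that] higher_pderiv_smult[of s "-1" M] by (simp add: da)
    qed (simp add: av M_val)
    show "poly ((pderiv ^^ s) (a + [:0, 1:])) (-1) = 0"
    proof (rule higher_pderiv_vanish_Suc[OF _ _ s])
      have "pderiv (a + [:0, 1:]) = 1 - M" by (simp add: pderiv_add da pderiv_pCons one_pCons)
      then show "poly ((pderiv ^^ s) (pderiv (a + [:0, 1:]))) (-1) = 0" if "s < Suc n" for s
        using M_left[OF that] by simp
    qed (simp add: av M_val)
  next
    fix t :: real
    show "poly b (- t) = 1 - poly b t" by (simp add: bv M_reflect del: power_Suc)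
    show "poly a (- t) = poly a t + t" by (simp add: av M_reflect del: power_Suc) (simp add: algebra_simps)
    assume t: "0 \<le> t" "t \<le> 1"
    have bM: "poly b t \<le> poly M t"
      using Wnn[of t "Suc n"] t \<kappa> by (simp add: bv del: power_Suc)
    have M2: "poly M t \<le> 1/2" using M_le[OF t] t by simp
    then show b2: "poly b t \<le> 1/2" using bM by simp
    show "poly a t \<le> (1 - t) / 4"
    proof -
      \<comment> \<open>The difference vanishes at 1 and is nondecreasing, since \<open>M\<close>
        lies below its chord.\<close>
      have "poly a t - (1 - t)\<^sup>2 / 4 \<le> poly a 1 - (1 - 1)\<^sup>2 / 4"
      proof (rule DERIV_nonneg_imp_nondecreasing[OF t(2), of "\<lambda>x. poly a x - (1 - x)\<^sup>2 / 4"])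
        fix x assume x: "t \<le> x" "x \<le> 1"
        have "((\<lambda>x. poly a x - (1 - x)\<^sup>2 / 4) has_real_derivative (- poly M x + (1 - x) / 2)) (at x)"
          using poly_DERIV[of a x] by (auto intro!: derivative_eq_intros simp: da field_simps)
        moreover have "0 \<le> - poly M x + (1 - x) / 2" using M_le[of x] x t by simp
        ultimately show "\<exists>y. ((\<lambda>x. poly a x - (1 - x)\<^sup>2 / 4) has_real_derivative y) (at x) \<and> 0 \<le> y"
          by blast
      qed
      then have "poly a t \<le> (1 - t)\<^sup>2 / 4" by (simp add: av M_val)
      also have "\<dots> \<le> (1 - t) / 4"
        using t mult_left_le[of "1 - t" "1 - t"] by (simp add: power2_eq_square)
      finally show ?thesis .
    qed
    \<comment> \<open>Since \<open>a' = - M\<close>, the target equals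
      \<open>1 + M - 3 b - t b'\<close>. Here \<open>b \<le> M\<close> and
      \<open>b \<le> 1/2\<close> make \<open>1 + M - 3 b\<close> nonnegative, and
      \<open>- t b'\<close> is the present product.\<close>
    have "0 \<le> t * ((2 * real n + 3) * \<kappa> * (1 - t\<^sup>2) ^ Suc n)"
      using t \<kappa>(1) Wnn[of t "Suc n"] by (intro mult_nonneg_nonneg) auto
    then show "0 \<le> 1 - poly (pderiv a) t - 3 * poly b t - t * poly (pderiv b) t"
      using bM b2 by (simp add: da db W del: power_Suc)
  qed
  then show thesis by (rule that)
qed

section \<open>Norms of the kernels\<close>

lemma integral_reflect_II: "integral II (\<lambda>t. h (- t)) = integral II (h :: real \<Rightarrow> real)"
  using Henstock_Kurzweil_Integration.integral_reflect_real[of 1 "-1" h] by simp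

lemma integral_fold_II:
  fixes h :: "real \<Rightarrow> real"
  assumes "h integrable_on II"
  shows "integral II h = integral {0..1} (\<lambda>t. h t + h (- t))"
proof -
  have i: "h integrable_on {-1..0}" "h integrable_on {0..1}"
    using assms by (auto intro: integrable_on_subinterval)
  have "(\<lambda>t. h (- t)) integrable_on {0..1}"
    using Henstock_Kurzweil_Integration.integrable_reflect_real[where f = h and a = "-1" and b = 0] i(1) by simp
  moreover have "integral {0..1} (\<lambda>t. h (- t)) = integral {-1..0} h"
    using Henstock_Kurzweil_Integration.integral_reflect_real[of 0 "-1" h] by simp
  ultimately have "integral {0..1} (\<lambda>t. h t + h (- t)) = integral {0..1} h + integral {-1..0} h"
    using i by (simp add: Henstock_Kurzweil_Integration.integral_add)
  then show ?thesis
    using Henstock_Kurzweil_Integration.integral_combine[of "-1" 0 1 h] assms by simp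
qed

lemma L2_sq_integrable_on: "u \<in> L2 \<Longrightarrow> (\<lambda>t. (u t)\<^sup>2) integrable_on II"
  using L2_sq_integrable[of u] by (auto simp: integrable_on_lebesgue_on)

lemma norm2_mono:
  assumes "u \<in> L2" "v \<in> L2" "\<And>t. t \<in> II \<Longrightarrow> \<bar>u t\<bar> \<le> \<bar>v t\<bar>"
  shows "norm2 u \<le> norm2 v"
proof -
  have "(norm2 u)\<^sup>2 \<le> (norm2 v)\<^sup>2"
    unfolding norm2_sq_integral[OF assms(1)] norm2_sq_integral[OF assms(2)]
    using assms by (intro integral_le L2_sq_integrable_on) (auto simp: abs_le_square_iff)
  then show ?thesis by (rule power2_le_imp_le) (rule norm2_nonneg)
qed

lemma norm2_reflect:
  assumes "u \<in> L2" "v \<in> L2" "\<And>t. t \<in> II \<Longrightarrow> \<bar>u t\<bar> = \<bar>v (- t)\<bar>"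
  shows "norm2 u = norm2 v"
proof -
  have "integral II (\<lambda>t. (u t)\<^sup>2) = integral II (\<lambda>t. (v (- t))\<^sup>2)"
    using assms(3) by (intro integral_cong) (metis power2_abs)
  also have "\<dots> = integral II (\<lambda>t. (v t)\<^sup>2)"
    by (rule integral_reflect_II)
  finally have "(norm2 u)\<^sup>2 = (norm2 v)\<^sup>2"
    using norm2_sq_integral[OF assms(1)] norm2_sq_integral[OF assms(2)] by simp
  then show ?thesis by (simp add: norm2_nonneg)
qed

text \<open>Parity flips with each differentiation: both sides of the reflection identity are
  differentiated, and uniqueness of the derivative gives the induction step.\<close>

lemma higher_pderiv_reflect:
  fixes p :: "real poly"
  assumes "\<And>t. poly p (- t) = \<sigma> * poly p t"
  shows "poly ((pderiv ^^ s) p) (- t) = (-1) ^ s * \<sigma> * poly ((pderiv ^^ s) p) t"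
proof (induction s arbitrary: t)
  case 0
  then show ?case using assms by simp
next
  case (Suc s)
  let ?q = "(pderiv ^^ s) p"
  have "((\<lambda>t. poly ?q (- t)) has_real_derivative - poly (pderiv ?q) (- t)) (at t)"
    by (auto intro!: derivative_eq_intros)
  moreover have "((\<lambda>t. (-1) ^ s * \<sigma> * poly ?q t) has_real_derivative (-1) ^ s * \<sigma> * poly (pderiv ?q) t) (at t)"
    by (auto intro!: derivative_eq_intros)
  ultimately have "- poly (pderiv ?q) (- t) = (-1) ^ s * \<sigma> * poly (pderiv ?q) t"
    unfolding Suc.IH by (rule DERIV_unique)
  then show ?case by simp
qed

lemma higher_pderiv_low_degree:
  fixes p :: "real poly"
  assumes "degree p < s"
  shows "(pderiv ^^ s) p = 0"
  using assms
proof (induction s arbitrary: p)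
  case (Suc s)
  show ?case
  proof (cases "degree p = 0")
    case True
    then have "pderiv p = 0" by (simp add: pderiv_eq_0_iff)
    moreover have "(pderiv ^^ s) (0 :: real poly) = 0" by (induction s) auto
    ultimately show ?thesis by (simp add: funpow_swap1)
  next
    case False
    then have "degree (pderiv p) < s" using Suc.prems by (simp add: degree_pderiv)
    from Suc.IH[OF this] show ?thesis by (simp add: funpow_swap1)
  qed
qed simp

section \<open>Comparison of the kernel norms with their values at the end points\<close>

context kernel_pair
begin

lemma b_ge_half: "poly b t \<ge> 1 / 2" if "-1 \<le> t" "t \<le> 0"
  using b_le_half[of "- t"] b_reflect[of t] that by simp

lemma higher_pderiv_const: "(pderiv ^^ r) [:c:] = (0 :: real poly)"
  using r by (intro higher_pderiv_low_degree) simp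

lemma higher_pderiv_linear: "(pderiv ^^ r) [:c, d:] = (0 :: real poly)"
  using r by (intro higher_pderiv_low_degree) simp

text \<open>\<open>a + t/2\<close> is even and \<open>b - 1/2\<close> is odd. At least three
  differentiations remove the linear and constant corrections, so the derivatives of order
  \<open>r\<close> have opposite parity and their product is odd.\<close>

lemma orthogonal:
  "integral II (\<lambda>t. poly ((pderiv ^^ r) a) t * poly ((pderiv ^^ r) b) t) = 0"
proof -
  define h where "h = (\<lambda>t. poly ((pderiv ^^ r) a) t * poly ((pderiv ^^ r) b) t)"
  have "poly (a + [:0, 1/2:]) (- t) = 1 * poly (a + [:0, 1/2:]) t" for t
    by (simp add: a_reflect)
  from higher_pderiv_reflect[OF this, of r]
  have "poly ((pderiv ^^ r) a) (- t) = (-1) ^ r * poly ((pderiv ^^ r) a) t" for t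
    by (simp add: higher_pderiv_add higher_pderiv_linear)
  moreover have "poly (b + [:- 1/2:]) (- t) = (-1) * poly (b + [:- 1/2:]) t" for t
    by (simp add: b_reflect)
  from higher_pderiv_reflect[OF this, of r]
  have "poly ((pderiv ^^ r) b) (- t) = - ((-1) ^ r * poly ((pderiv ^^ r) b) t)" for t
    by (simp add: higher_pderiv_add higher_pderiv_const)
  ultimately have "h (- t) = - h t" for t
    by (simp add: h_def algebra_simps flip: power_mult_distrib)
  then have "integral II h = - integral II h"
    using integral_reflect_II[of h] by simp
  then show ?thesis by (simp add: h_def)
qed

text \<open>By orthogonality the squared norm is a constant plus \<open>x^2\<close> times a
  nonnegative number, hence largest for \<open>\<bar>x\<bar> = 1\<close>; the value
  \<open>x = -1\<close> gives \<open>a - b\<close>.\<close>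

lemma norm2_top_derivative_le:
  assumes "\<bar>x\<bar> \<le> 1"
  shows "norm2 (poly ((pderiv ^^ r) (a + smult x b))) \<le> norm2 (poly ((pderiv ^^ r) (a - b)))"
proof -
  define \<alpha> where "\<alpha> = poly ((pderiv ^^ r) a)"
  define \<beta> where "\<beta> = poly ((pderiv ^^ r) b)"
  have cont: "continuous_on II \<alpha>" "continuous_on II \<beta>"
    unfolding \<alpha>_def \<beta>_def by (auto intro!: continuous_intros)
  have *: "(norm2 (poly ((pderiv ^^ r) (a + smult y b))))\<^sup>2 = integral II (\<lambda>t. (\<alpha> t)\<^sup>2) + y\<^sup>2 * integral II (\<lambda>t. (\<beta> t)\<^sup>2)" for y
  proof -
    have "(norm2 (poly ((pderiv ^^ r) (a + smult y b))))\<^sup>2 =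
        integral II (\<lambda>t. (\<alpha> t)\<^sup>2 + y\<^sup>2 * (\<beta> t)\<^sup>2 + 2 * y * (\<alpha> t * \<beta> t))"
      unfolding norm2_sq_integral[OF L2_poly]
      by (intro integral_cong)
        (simp add: higher_pderiv_add higher_pderiv_smult \<alpha>_def \<beta>_def power2_eq_square algebra_simps)
    also have "\<dots> = integral II (\<lambda>t. (\<alpha> t)\<^sup>2 + y\<^sup>2 * (\<beta> t)\<^sup>2) + integral II (\<lambda>t. 2 * y * (\<alpha> t * \<beta> t))"
      by (intro integral_add integrable_continuous_real continuous_intros cont)
    also have "integral II (\<lambda>t. (\<alpha> t)\<^sup>2 + y\<^sup>2 * (\<beta> t)\<^sup>2) = integral II (\<lambda>t. (\<alpha> t)\<^sup>2) + integral II (\<lambda>t. y\<^sup>2 * (\<beta> t)\<^sup>2)"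
      by (intro integral_add integrable_continuous_real continuous_intros cont)
    also have "integral II (\<lambda>t. 2 * y * (\<alpha> t * \<beta> t)) = 0"
      using orthogonal by (simp add: \<alpha>_def \<beta>_def)
    finally show ?thesis by simp
  qed
  have "x\<^sup>2 \<le> 1" using assms by (simp add: abs_square_le_1)
  moreover have "0 \<le> integral II (\<lambda>t. (\<beta> t)\<^sup>2)"
    by (intro integral_nonneg integrable_continuous_real continuous_intros cont) auto
  ultimately have "x\<^sup>2 * integral II (\<lambda>t. (\<beta> t)\<^sup>2) \<le> 1 * integral II (\<lambda>t. (\<beta> t)\<^sup>2)"
    by (rule mult_right_mono)
  then have "(norm2 (poly ((pderiv ^^ r) (a + smult x b))))\<^sup>2 \<le> (norm2 (poly ((pderiv ^^ r) (a + smult (-1) b))))\<^sup>2"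
    unfolding * by simp
  then show ?thesis
    using power2_le_imp_le[OF _ norm2_nonneg] by simp
qed

text \<open>For \<open>x \<le> 0\<close> the kernel differs from \<open>b\<close> only where
  \<open>b \<ge> 1/2\<close>, so that \<open>b - 1\<close> is no larger in modulus. For
  \<open>x > 0\<close> it is dominated by \<open>b - 1\<close> in the same way, and reflection shows
  that \<open>b - 1\<close> and \<open>b\<close> have equal norms.\<close>

lemma step_kernel_norm:
  "norm2 (\<lambda>t. if t \<le> x then poly (b - 1) t else poly b t) \<le> norm2 (poly b)"
proof (cases "x \<le> 0")
  case True
  show ?thesis
  proof (rule norm2_mono[OF L2_piecewise_poly L2_poly])
    fix t :: real assume "t \<in> II"
    then show "\<bar>if t \<le> x then poly (b - 1) t else poly b t\<bar> \<le> \<bar>poly b t\<bar>"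
      using b_ge_half[of t] True by auto
  qed
next
  case False
  have "norm2 (\<lambda>t. if t \<le> x then poly (b - 1) t else poly b t) \<le> norm2 (poly (b - 1))"
  proof (rule norm2_mono[OF L2_piecewise_poly L2_poly])
    fix t :: real assume "t \<in> II"
    then show "\<bar>if t \<le> x then poly (b - 1) t else poly b t\<bar> \<le> \<bar>poly (b - 1) t\<bar>"
      using b_le_half[of t] False by auto
  qed
  also have "\<dots> = norm2 (poly b)"
    by (rule norm2_reflect[OF L2_poly L2_poly]) (simp add: b_reflect)
  finally show ?thesis .
qed

text \<open>The kernel for the derivative of order \<open>r - 2\<close>. The branches differ by
  \<open>t - x\<close>, so it is continuous in \<open>t\<close> and only its slope jumps at
  \<open>x\<close>.\<close>

definition ramp :: "real \<Rightarrow> real \<Rightarrow> real" where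
  "ramp x t = (if t \<le> x then poly (a + smult x b + [:- x, 1:]) t else poly (a + smult x b) t)"

lemma ramp_L2: "ramp x \<in> L2"
  unfolding ramp_def[abs_def] by (rule L2_piecewise_poly)

lemma ramp_reflect: "ramp (- x) (- t) = ramp x t"
  by (auto simp: ramp_def a_reflect b_reflect algebra_simps)

definition energy :: "real \<Rightarrow> real" where
  "energy x = integral II (\<lambda>t. (ramp x t)\<^sup>2)"

lemma energy_even: "energy (- x) = energy x"
proof -
  have "energy (- x) = integral II (\<lambda>t. (ramp (- x) (- t))\<^sup>2)"
    unfolding energy_def by (rule integral_reflect_II[symmetric])
  then show ?thesis by (simp add: ramp_reflect energy_def)
qed

lemma energy_left: "energy (-1) = integral II (\<lambda>t. (poly a t - poly b t)\<^sup>2)"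
  unfolding energy_def by (rule integral_cong) (auto simp: ramp_def)

text \<open>Folding both integrals onto \<open>{0..1}\<close> makes them comparable pointwise; for
  \<open>x = 0\<close> the two halves of the kernel both contribute \<open>a^2\<close>.\<close>

lemma energy_0_le_1: "energy 0 \<le> energy 1"
proof -
  let ?d = "\<lambda>t. poly a t - poly b t"
  have d: "?d \<in> L2" by (intro L2_continuous continuous_intros)
  have "energy 0 = integral {0..1} (\<lambda>t. (ramp 0 t)\<^sup>2 + (ramp 0 (- t))\<^sup>2)"
    unfolding energy_def by (rule integral_fold_II[OF L2_sq_integrable_on[OF ramp_L2]])
  also have "\<dots> = integral {0..1} (\<lambda>t. 2 * (poly a t)\<^sup>2)"
    by (rule integral_cong) (auto simp: ramp_def a_reflect)
  also have "\<dots> \<le> integral {0..1} (\<lambda>t. (?d t)\<^sup>2 + (?d (- t))\<^sup>2)"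
  proof (rule integral_le)
    fix t :: real assume t: "t \<in> {0..1}"
    define A B u where "A = poly a t" and "B = poly b t" and "u = 1 - t"
    \<comment> \<open>The reflected difference is \<open>A + B - u\<close>. Completing the square in
      \<open>B\<close> leaves a term whose sign is given by
      \<open>a \<le> (1 - t) / 4\<close>.\<close>
    have "(?d t)\<^sup>2 + (?d (- t))\<^sup>2 - 2 * (poly a t)\<^sup>2 = (2 * B - u)\<^sup>2 / 2 + 2 * u * (u / 4 - A)"
      by (simp add: A_def B_def u_def a_reflect b_reflect power2_eq_square field_simps)
    moreover have "0 \<le> 2 * u * (u / 4 - A)"
      using a_le[of t] t by (intro mult_nonneg_nonneg) (auto simp: u_def A_def)
    ultimately show "2 * (poly a t)\<^sup>2 \<le> (?d t)\<^sup>2 + (?d (- t))\<^sup>2"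
      by (smt (verit) zero_le_power2 divide_nonneg_pos)
  qed (auto intro!: integrable_continuous_real continuous_intros)
  also have "\<dots> = energy (-1)"
    unfolding energy_left by (rule integral_fold_II[symmetric, OF L2_sq_integrable_on[OF d]])
  finally show ?thesis by (simp add: energy_even)
qed

text \<open>On \<open>{-1..1}\<close> the energy is an explicit polynomial function \<open>E\<close>
  of \<open>x\<close> with successive derivatives \<open>E1\<close> and \<open>E2\<close>. Convexity
  of \<open>E1\<close> with \<open>E1 0 = 0\<close> allows only one change of sign on
  \<open>{0..1}\<close>, from negative to positive.\<close>

lemma energy_le:
  assumes "\<bar>x\<bar> \<le> 1"
  shows "energy x \<le> energy (-1)"
proof -
  obtain R where R: "pderiv R = a * a" "poly R (-1) = 0" by (rule poly_antiderivative)
  obtain S where S: "pderiv S = a * b" "poly S (-1) = 0" by (rule poly_antiderivative)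
  obtain T where T: "pderiv T = b * b" "poly T (-1) = 0" by (rule poly_antiderivative)
  obtain A1 where A1: "pderiv A1 = a" "poly A1 (-1) = 0" by (rule poly_antiderivative)
  obtain A2 where A2: "pderiv A2 = A1" "poly A2 (-1) = 0" by (rule poly_antiderivative)
  obtain B1 where B1: "pderiv B1 = b" "poly B1 (-1) = 0" by (rule poly_antiderivative)
  obtain B2 where B2: "pderiv B2 = B1" "poly B2 (-1) = 0" by (rule poly_antiderivative)
  \<comment> \<open>\<open>R\<close>, \<open>S\<close> and \<open>T\<close> integrate the square of
    \<open>a + x b\<close> over the whole interval. The other terms come from the summand
    \<open>t - x\<close> on the left: its square gives \<open>(x + 1)^3 / 3\<close>, and integrating
    the mixed terms by parts gives \<open>A2\<close> and \<open>B2\<close>.\<close>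
  define E where "E = (\<lambda>x. poly R 1 + 2 * x * poly S 1 + x\<^sup>2 * poly T 1 + (x + 1) ^ 3 / 3 - 2 * poly A2 x - 2 * x * poly B2 x)"
  define E1 where "E1 = (\<lambda>x. 2 * poly S 1 + 2 * x * poly T 1 + (x + 1)\<^sup>2 - 2 * poly A1 x - 2 * poly B2 x - 2 * x * poly B1 x)"
  define E2 where "E2 = (\<lambda>x. 2 * poly T 1 + 2 * (x + 1) - 2 * poly a x - 4 * poly B1 x - 2 * x * poly b x)"
  have dE: "(E has_real_derivative E1 x) (at x)" for x
    unfolding E_def E1_def
    by (auto intro!: derivative_eq_intros simp: A2 B2 power2_eq_square algebra_simps)
  have dE1: "(E1 has_real_derivative E2 x) (at x)" for x
    unfolding E1_def E2_def
    by (auto intro!: derivative_eq_intros simp: A1 B1 B2) 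
  have dE2: "(E2 has_real_derivative 2 * (1 - poly (pderiv a) x - 3 * poly b x - x * poly (pderiv b) x)) (at x)" for x
    unfolding E2_def
    by (auto intro!: derivative_eq_intros simp: B1) 
  have E: "energy x = E x" if x: "-1 \<le> x" "x \<le> 1" for x
  proof -
    define \<Psi> where "\<Psi> = (\<lambda>t. poly R t + 2 * x * poly S t + x\<^sup>2 * poly T t)"
    \<comment> \<open>For fixed \<open>x\<close>, \<open>\<Psi>\<close> and \<open>\<Phi>\<close>
      are antiderivatives in \<open>t\<close> of the squared kernel right and left of
      \<open>x\<close>.\<close>
    define \<Phi> where "\<Phi> = (\<lambda>t. \<Psi> t - (x - t) ^ 3 / 3 - 2 * (poly A1 t * (x - t) + poly A2 t) - 2 * x * (poly B1 t * (x - t) + poly B2 t))"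
    have d\<Psi>: "(\<Psi> has_real_derivative (poly (a + smult x b) t)\<^sup>2) (at t)" for t
      unfolding \<Psi>_def
      by (auto intro!: derivative_eq_intros simp: R S T power2_eq_square algebra_simps)
    have d\<Phi>: "(\<Phi> has_real_derivative (poly (a + smult x b + [:- x, 1:]) t)\<^sup>2) (at t)" for t
      unfolding \<Phi>_def
      by (auto intro!: derivative_eq_intros d\<Psi> simp: A1 A2 B1 B2 power2_eq_square algebra_simps)
        (simp add: field_simps)
    have "((\<lambda>t. (ramp x t)\<^sup>2) has_integral (\<Phi> x - \<Phi> (-1))) {-1..x}"
    proof (rule has_integral_eq[OF _ fundamental_theorem_of_calculus[OF x(1)]])
      show "(\<Phi> has_vector_derivative (poly (a + smult x b + [:- x, 1:]) t)\<^sup>2) (at t within {-1..x})" for t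
        using d\<Phi> has_real_derivative_iff_has_vector_derivative has_field_derivative_at_within by blast
    qed (simp add: ramp_def)
    moreover have "((\<lambda>t. (ramp x t)\<^sup>2) has_integral (\<Psi> 1 - \<Psi> x)) {x..1}"
    proof (rule has_integral_eq[OF _ fundamental_theorem_of_calculus[OF x(2)]])
      show "(\<Psi> has_vector_derivative (poly (a + smult x b) t)\<^sup>2) (at t within {x..1})" for t
        using d\<Psi> has_real_derivative_iff_has_vector_derivative has_field_derivative_at_within by blast
    qed (auto simp: ramp_def)
    ultimately have "((\<lambda>t. (ramp x t)\<^sup>2) has_integral (\<Phi> x - \<Phi> (-1)) + (\<Psi> 1 - \<Psi> x)) II"
      by (rule has_integral_combine[OF x])
    then have "energy x = (\<Phi> x - \<Phi> (-1)) + (\<Psi> 1 - \<Psi> x)"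
      unfolding energy_def by (rule integral_unique)
    then show ?thesis
      by (simp add: \<Phi>_def \<Psi>_def E_def R S T A1 A2 B1 B2)
  qed
  \<comment> \<open>\<open>E\<close> inherits evenness from the energy, so its derivative at 0
    equals its own negative. The formula represents the energy only on \<open>{-1..1}\<close>, hence
    the neighbourhood.\<close>
  have E1_0: "E1 0 = 0"
  proof -
    have "((\<lambda>x. E (- x)) has_real_derivative - E1 0) (at 0)"
      using DERIV_mirror[of E "E1 0" 0] dE[of 0] by simp
    moreover have "\<forall>\<^sub>F x in nhds 0. E (- x) = E x"
    proof -
      have "\<forall>\<^sub>F x in nhds (0::real). x \<in> {-1<..<1}"
        by (rule eventually_nhds_in_open) auto
      then show ?thesis
      proof eventually_elim
        case (elim x)
        then show ?case using E[of x] E[of "- x"] energy_even[of x] by simp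
      qed
    qed
    ultimately have "(E has_real_derivative - E1 0) (at 0)"
      using DERIV_cong_ev[of 0 0 "\<lambda>x. E (- x)" E "- E1 0" "- E1 0"] by simp
    then have "- E1 0 = E1 0" using dE DERIV_unique by blast
    then show ?thesis by simp
  qed
  have E2_mono: "E2 y \<le> E2 z" if "0 \<le> y" "y \<le> z" "z \<le> 1" for y z
  proof (rule DERIV_nonneg_imp_nondecreasing[OF that(2), of E2])
    fix t assume "y \<le> t" "t \<le> z"
    then have "0 \<le> 2 * (1 - poly (pderiv a) t - 3 * poly b t - t * poly (pderiv b) t)"
      using third_derivative[of t] that by simp
    then show "\<exists>d. (E2 has_real_derivative d) (at t) \<and> 0 \<le> d"
      using dE2 by blast
  qed
  have conv: "convex_on {0..1} E1"
    by (rule convex_on_realI[where f' = E2]) (auto intro: dE1 E2_mono)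
  \<comment> \<open>If \<open>E1 x \<le> 0\<close>, convexity keeps \<open>E1\<close> nonpositive on
    \<open>{0..x}\<close>, so \<open>E x \<le> E 0 \<le> E 1\<close>. Otherwise \<open>E1\<close>
    stays positive on \<open>{x..1}\<close> and \<open>E\<close> increases there.\<close>
  have main: "E x \<le> E 1" if x: "0 \<le> x" "x \<le> 1" for x
  proof (cases "E1 x \<le> 0")
    case True
    have "E x \<le> E 0"
    proof (rule DERIV_nonpos_imp_nonincreasing[OF x(1), of E])
      fix y assume y: "0 \<le> y" "y \<le> x"
      have "E1 y \<le> 0"
      proof (cases "x = 0")
        case False
        then have "y / x \<in> {0..1}" "(y / x) * x = y" using y by auto
        with convex_onD[OF conv, of "y / x" 0 x] x
        have "E1 y \<le> (y / x) * E1 x" by (simp add: E1_0)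
        also have "\<dots> \<le> 0" using True \<open>y / x \<in> {0..1}\<close> by (intro mult_nonneg_nonpos) simp_all
        finally show ?thesis .
      qed (use y E1_0 in auto)
      then show "\<exists>d. (E has_real_derivative d) (at y) \<and> d \<le> 0" using dE by blast
    qed
    also have "\<dots> \<le> E 1" using energy_0_le_1 by (simp add: E)
    finally show ?thesis .
  next
    case False
    then have "x \<noteq> 0" using E1_0 by auto
    show ?thesis
    proof (rule DERIV_nonneg_imp_nondecreasing[OF x(2), of E])
      fix y assume y: "x \<le> y" "y \<le> 1"
      have "x / y \<in> {0..1}" "(x / y) * y = x" using y x \<open>x \<noteq> 0\<close> by auto
      with convex_onD[OF conv, of "x / y" 0 y] x y
      have "E1 x \<le> (x / y) * E1 y" by (simp add: E1_0)
      then have "0 < (x / y) * E1 y" using False by simp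
      then have "0 < E1 y" using \<open>x / y \<in> {0..1}\<close> zero_less_mult_pos[of "x / y" "E1 y"]
        by (cases "x / y = 0") auto
      then have "0 \<le> E1 y" by simp
      then show "\<exists>d. (E has_real_derivative d) (at y) \<and> 0 \<le> d" using dE by blast
    qed
  qed
  have "energy \<bar>x\<bar> \<le> energy 1" using main[of "\<bar>x\<bar>"] assms by (simp add: E)
  moreover have "energy \<bar>x\<bar> = energy x" using energy_even by (auto simp: abs_if)
  ultimately show ?thesis by (simp add: energy_even)
qed

lemma ramp_kernel_norm:
  assumes "\<bar>x\<bar> \<le> 1"
  shows "norm2 (ramp x) \<le> norm2 (poly (a - b))"
proof -
  have "(norm2 (ramp x))\<^sup>2 \<le> (norm2 (poly (a - b)))\<^sup>2"
    using energy_le[OF assms] energy_left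
    by (simp add: norm2_sq_integral[OF ramp_L2] norm2_sq_integral[OF L2_poly] energy_def)
  then show ?thesis by (rule power2_le_imp_le) (rule norm2_nonneg)
qed

end

section \<open>The inequality and its sharpness\<close>

lemma u0_eqI:
  assumes "r \<ge> 1" "u0_conditions r k p"
  shows "u0 r k = p"
  unfolding u0_def using assms u0_conditions_ex1 by (intro the1_equality)

text \<open>\<open>derivI j (poly p)\<close> is controlled only on \<open>II\<close>, so the
  induction carries its value and its derivative within \<open>II\<close> together.\<close>

lemma derivI_poly:
  assumes "x \<in> II"
  shows "derivI j (poly p) x = poly ((pderiv ^^ j) p) x"
    and "(derivI j (poly p) has_vector_derivative poly ((pderiv ^^ Suc j) p) x) (at x within II)"
proof -
  have *: "\<forall>x\<in>II. derivI j (poly p) x = poly ((pderiv ^^ j) p) x \<and>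
      (derivI j (poly p) has_vector_derivative poly ((pderiv ^^ Suc j) p) x) (at x within II)" for j
  proof (induction j)
    case 0
    then show ?case by (simp add: poly_has_vector_derivative)
  next
    case (Suc j)
    have eq: "derivI (Suc j) (poly p) x = poly ((pderiv ^^ Suc j) p) x" if "x \<in> II" for x
    proof -
      have "vector_derivative (derivI j (poly p)) (at x within cbox (-1) 1) = poly ((pderiv ^^ Suc j) p) x"
        using Suc.IH that by (intro vector_derivative_within_cbox) auto
      then show ?thesis by (simp add: derivI_Suc)
    qed
    moreover have "(derivI (Suc j) (poly p) has_vector_derivative poly ((pderiv ^^ Suc (Suc j)) p) x) (at x within II)"
      if "x \<in> II" for x
    proof (rule has_vector_derivative_transform[OF that])
      show "(poly ((pderiv ^^ Suc j) p) has_vector_derivative poly ((pderiv ^^ Suc (Suc j)) p) x) (at x within II)"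
        using poly_has_vector_derivative[of "(pderiv ^^ Suc j) p"] by simp
    qed (use eq in simp)
    ultimately show ?case by blast
  qed
  show "derivI j (poly p) x = poly ((pderiv ^^ j) p) x"
    "(derivI j (poly p) has_vector_derivative poly ((pderiv ^^ Suc j) p) x) (at x within II)"
    using * assms by blast+
qed

lemma abs_continuous_const: "abs_continuous_on_Icc c d (\<lambda>_. k)"
  unfolding abs_continuous_on_Icc_def by (auto intro: exI[of _ 1])

lemma poly_in_L2r: "poly p \<in> L2r r"
proof -
  have "derivI j (poly p) differentiable_on II" for j
    unfolding differentiable_on_def using derivI_poly(2) differentiableI_vector by blast
  moreover have "abs_continuous_on_Icc (-1) 1 (derivI (r - 1) (poly p))"
  proof -
    obtain M L where "\<And>x. x \<in> II \<Longrightarrow> \<bar>poly ((pderiv ^^ (r - 1)) p) x\<bar> \<le> M"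
      "\<And>x y. x \<in> II \<Longrightarrow> y \<in> II \<Longrightarrow> \<bar>poly ((pderiv ^^ (r - 1)) p) y - poly ((pderiv ^^ (r - 1)) p) x\<bar> \<le> L * \<bar>y - x\<bar>"
      using poly_lipschitz_on_II by blast
    \<comment> \<open>A Lipschitz function is absolutely continuous: the product lemma is applied
      with the constant factor 1.\<close>
    then have "abs_continuous_on_Icc (-1) 1 (\<lambda>x. derivI (r - 1) (poly p) x * 1)"
      by (intro abs_continuous_mult_lipschitz[where M = M and L = L] abs_continuous_const) (simp_all add: derivI_poly(1))
    then show ?thesis by simp
  qed
  moreover have "derivI r (poly p) \<in> L2"
  proof (rule L2_continuous)
    show "continuous_on II (derivI r (poly p))"
      by (rule continuous_on_eq[where f = "poly ((pderiv ^^ r) p)"]) (auto intro!: continuous_intros simp: derivI_poly(1))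
  qed
  ultimately show ?thesis by (simp add: L2r_def)
qed

lemma norm2_cong: "(\<And>x. x \<in> II \<Longrightarrow> u x = v x) \<Longrightarrow> norm2 u = norm2 v"
  unfolding norm2_def by (intro arg_cong[where f = sqrt] Bochner_Integration.integral_cong) (auto simp: space_restrict_space)

section \<open>Essential suprema of continuous functions\<close>

lemma norm_inf_le:
  assumes "continuous_on II u" "\<And>x. x \<in> II \<Longrightarrow> \<bar>u x\<bar> \<le> c"
  shows "norm_inf u \<le> ereal c"
  unfolding norm_inf_def
proof (rule esssup_I)
  have "u \<in> borel_measurable (lebesgue_on II)"
    using assms(1) by (rule continuous_imp_measurable_on_sets_lebesgue) simp
  then show "(\<lambda>x. ereal \<bar>u x\<bar>) \<in> borel_measurable (lebesgue_on II)" by measurable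
  show "AE x in lebesgue_on II. ereal \<bar>u x\<bar> \<le> ereal c"
    using assms(2) by (intro AE_I2) (simp add: space_restrict_space)
qed

text \<open>Otherwise, by continuity, \<open>\<bar>u\<bar>\<close> would exceed the essential
  supremum on an interval adjacent to -1, which has positive measure.\<close>

lemma norm_inf_ge_left:
  assumes "continuous_on II u"
  shows "ereal \<bar>u (-1)\<bar> \<le> norm_inf u"
proof (rule ccontr)
  assume "\<not> ?thesis"
  then have "norm_inf u < ereal \<bar>u (-1)\<bar>" by simp
  then obtain c where c: "norm_inf u < ereal c" "ereal c < ereal \<bar>u (-1)\<bar>" by (meson ereal_dense2)
  have "AE x in lebesgue_on II. ereal \<bar>u x\<bar> \<le> norm_inf u"
    unfolding norm_inf_def by (rule esssup_AE)
  then have "AE x in lebesgue. x \<in> II \<longrightarrow> ereal \<bar>u x\<bar> \<le> norm_inf u"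
    by (simp add: AE_restrict_space_iff)
  then obtain N where N: "negligible N" "{x. \<not> (x \<in> II \<longrightarrow> ereal \<bar>u x\<bar> \<le> norm_inf u)} \<subseteq> N"
    unfolding eventually_ae_filter_negligible by blast
  have "continuous_on II (\<lambda>x. \<bar>u x\<bar>)" using assms by (intro continuous_intros)
  moreover have "-1 \<in> II" "0 < \<bar>u (-1)\<bar> - c" using c(2) by auto
  ultimately have "\<exists>\<delta>>0. \<forall>y\<in>II. dist y (-1) < \<delta> \<longrightarrow> dist \<bar>u y\<bar> \<bar>u (-1)\<bar> < \<bar>u (-1)\<bar> - c"
    unfolding continuous_on_iff by meson
  then obtain \<delta> where \<delta>: "\<delta> > 0" "\<And>y. y \<in> II \<Longrightarrow> dist y (-1) < \<delta> \<Longrightarrow> dist \<bar>u y\<bar> \<bar>u (-1)\<bar> < \<bar>u (-1)\<bar> - c"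
    by blast
  have "{-1<..<min 1 (-1 + \<delta>)} \<subseteq> N"
  proof
    fix y assume y: "y \<in> {-1<..<min 1 (-1 + \<delta>)}"
    then have "dist \<bar>u y\<bar> \<bar>u (-1)\<bar> < \<bar>u (-1)\<bar> - c" by (intro \<delta>(2)) (auto simp: dist_real_def)
    then have "c < \<bar>u y\<bar>" by (auto simp: dist_real_def)
    then have "norm_inf u < ereal \<bar>u y\<bar>" using c(1) by (meson less_ereal.simps(1) less_trans)
    then have "\<not> (y \<in> II \<longrightarrow> ereal \<bar>u y\<bar> \<le> norm_inf u)" using y by auto
    then show "y \<in> N" using N(2) by blast
  qed
  then have "negligible {-1<..<min 1 (-1 + \<delta>)}" using N(1) negligible_subset by blast
  moreover have "{-1<..<min 1 (-1 + \<delta>)} \<noteq> {}" using \<delta>(1) by (auto simp: greaterThanLessThan_empty_iff)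
  ultimately show False
    using open_not_negligible[OF open_greaterThanLessThan, of "-1" "min 1 (-1 + \<delta>)"] by blast
qed

lemma norm_inf_derivative_le:
  assumes "f \<in> L2r r" "k < r" "\<And>x. x \<in> II \<Longrightarrow> \<bar>derivI k f x\<bar> \<le> c"
  shows "norm_inf (derivI k f) \<le> ereal c"
  by (rule norm_inf_le[OF L2r_continuous_on[OF assms(1,2)] assms(3)])

section \<open>Pointwise bounds and the identification of \<open>u0\<close>\<close>

context kernel_pair
begin

text \<open>The kernel is \<open>b - 1\<close> left and \<open>b\<close> right of \<open>x\<close>;
  its constant jump -1 corresponds to \<open>m = 0\<close>.\<close>

lemma derivative_bound_1:
  assumes f: "f \<in> L2r r" and x: "x \<in> II"
  shows "\<bar>derivI (r - 1) f x\<bar> \<le> norm2 (poly ((pderiv ^^ r) b)) * norm2 f + norm2 (poly b) * norm2 (derivI r f)"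
proof -
  have eq: "(pderiv ^^ r) (b - 1) = (pderiv ^^ r) b"
    using higher_pderiv_add[of r "b - 1" "[:1:]"] by (simp add: higher_pderiv_const one_pCons)
  have jump: "poly ((pderiv ^^ s) (b - 1 - b)) x = (if s = 0 then -1 else 0)" for s
    using higher_pderiv_low_degree[of "-1" s] by (cases "s = 0") auto
  have "\<bar>derivI (r - 1 - 0) f x\<bar> \<le> norm2 (poly ((pderiv ^^ r) (b - 1))) * norm2 f +
      norm2 (\<lambda>t. if t \<le> x then poly (b - 1) t else poly b t) * norm2 (derivI r f)"
    by (rule derivative_kernel_estimate[OF f _ _ _ b_left b_right eq jump]) (use x r in auto)
  also have "\<dots> \<le> norm2 (poly ((pderiv ^^ r) b)) * norm2 f + norm2 (poly b) * norm2 (derivI r f)"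
    unfolding eq using step_kernel_norm by (intro add_left_mono mult_right_mono norm2_nonneg)
  finally show ?thesis by simp
qed

text \<open>The kernel is \<open>ramp x\<close>. Of its jump \<open>t - x\<close> only the first
  derivative survives at \<open>x\<close>, so \<open>m = 1\<close>.\<close>

lemma derivative_bound_2:
  assumes f: "f \<in> L2r r" and x: "x \<in> II"
  shows "\<bar>derivI (r - 2) f x\<bar> \<le> norm2 (poly ((pderiv ^^ r) (a - b))) * norm2 f + norm2 (poly (a - b)) * norm2 (derivI r f)"
proof -
  let ?p = "a + smult x b + [:- x, 1:]" and ?q = "a + smult x b"
  have eq: "(pderiv ^^ r) ?p = (pderiv ^^ r) ?q"
    by (simp add: higher_pderiv_add higher_pderiv_linear)
  have jump: "poly ((pderiv ^^ s) (?p - ?q)) x = (if s = 1 then 1 else 0)" for s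
  proof -
    have pq: "?p - ?q = [:- x, 1:]" by simp
    show ?thesis
      unfolding pq using higher_pderiv_power_at[of s x 1] by auto
  qed
  have left: "poly ((pderiv ^^ s) ?p) (-1) = 0" if "s < r" for s
  proof -
    \<comment> \<open>This regrouping matches the interpolation conditions of \<open>a\<close> and
      \<open>b\<close> at -1.\<close>
    have "?p = (a + [:0, 1:]) + smult x (b - 1)" by (simp add: one_pCons smult_diff_right)
    then show ?thesis
      using a_left[OF that] b_left[OF that] by (simp only: higher_pderiv_add higher_pderiv_smult poly_add poly_smult)
  qed
  have right: "poly ((pderiv ^^ s) ?q) 1 = 0" if "s < r" for s
    using a_right[OF that] b_right[OF that] by (simp add: higher_pderiv_add higher_pderiv_smult)
  have "\<bar>derivI (r - 1 - 1) f x\<bar> \<le> norm2 (poly ((pderiv ^^ r) ?p)) * norm2 f +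
      norm2 (\<lambda>t. if t \<le> x then poly ?p t else poly ?q t) * norm2 (derivI r f)"
    by (rule derivative_kernel_estimate[OF f _ _ _ left right eq jump]) (use x r in auto)
  also have "(\<lambda>t. if t \<le> x then poly ?p t else poly ?q t) = ramp x"
    by (simp add: ramp_def fun_eq_iff)
  also have "norm2 (poly ((pderiv ^^ r) ?p)) * norm2 f + norm2 (ramp x) * norm2 (derivI r f)
      \<le> norm2 (poly ((pderiv ^^ r) (a - b))) * norm2 f + norm2 (poly (a - b)) * norm2 (derivI r f)"
    unfolding eq using x
    by (intro add_mono mult_right_mono norm2_nonneg norm2_top_derivative_le ramp_kernel_norm) auto
  finally show ?thesis by (simp add: numeral_2_eq_2)
qed

lemma u0_conditions_b: "u0_conditions r (r - 1) (smult ((-1) ^ (r - 2)) b)"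
proof -
  have "poly ((pderiv ^^ s) b) (-1) = (if s = 0 then 1 else 0)" if "s < r" for s
  proof -
    have "poly ((pderiv ^^ s) b) (-1) = poly ((pderiv ^^ s) (b - 1)) (-1) + poly ((pderiv ^^ s) 1) (-1)"
      using higher_pderiv_add[of s "b - 1" 1] by simp
    also have "poly ((pderiv ^^ s) 1) (-1) = (if s = 0 then 1 else 0 :: real)"
      using higher_pderiv_low_degree[of 1 s] by (cases "s = 0") auto
    finally show ?thesis using b_left[OF that] by simp
  qed
  moreover have "r - (r - 1) - 1 = 0" "r - 1 - 1 = r - 2" using r by auto
  ultimately show ?thesis
    unfolding u0_conditions_def using degree_b b_right by (auto simp: higher_pderiv_smult intro: order_trans[OF degree_smult_le])
qed

lemma u0_conditions_a: "u0_conditions r (r - 2) (smult ((-1) ^ (r - 2)) (a - b))"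
proof -
  have "poly ((pderiv ^^ s) (a - b)) (-1) = (if 1 = s then -1 else 0)" if "s < r" for s
  proof -
    have eq: "a - b + [:1, 1:] + (b - 1) = a + [:0, 1:]" by (simp add: one_pCons)
    have "poly ((pderiv ^^ s) (a - b)) (-1) + poly ((pderiv ^^ s) [:1, 1:]) (-1) + poly ((pderiv ^^ s) (b - 1)) (-1) =
        poly ((pderiv ^^ s) (a + [:0, 1:])) (-1)"
      using arg_cong[OF eq, of "\<lambda>p. poly ((pderiv ^^ s) p) (-1)"] by (simp only: higher_pderiv_add poly_add)
    moreover have "poly ((pderiv ^^ s) [:1, 1:]) (-1) = (if 1 = s then 1 else 0 :: real)"
      using higher_pderiv_power_at[of s "-1" 1] by auto
    ultimately show ?thesis using b_left[OF that] a_left[OF that] by (auto split: if_splits)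
  qed
  moreover have "poly ((pderiv ^^ s) (a - b)) 1 = 0" if "s < r" for s
    using higher_pderiv_add[of s "a - b" b] a_right[OF that] b_right[OF that] by simp
  \<comment> \<open>The slope -1 of \<open>a - b\<close> at the left end turns
    \<open>(-1)^(r - 2)\<close> into \<open>(-1)^(k - 1)\<close> for \<open>k = r - 2\<close>;
    \<open>r \<ge> 3\<close> keeps the truncated subtractions exact.\<close>
  moreover have "r - (r - 2) - 1 = 1" "(-1) ^ (r - 2) * -1 = (-1 :: real) ^ (r - 2 - 1)"
  proof -
    have "r = Suc (Suc (Suc (r - 3)))" using r by simp
    then obtain m where "r = Suc (Suc (Suc m))" by blast
    then show "r - (r - 2) - 1 = 1" "(-1) ^ (r - 2) * -1 = (-1 :: real) ^ (r - 2 - 1)" by simp_all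
  qed
  moreover have "degree (smult ((-1) ^ (r - 2)) (a - b)) \<le> 2 * r - 1"
    using degree_diff_le[OF degree_a degree_b] by (rule order_trans[OF degree_smult_le])
  ultimately show ?thesis
    unfolding u0_conditions_def by (auto simp: higher_pderiv_smult)
qed

end

lemma norm2_smult: "norm2 (poly (smult c p)) = \<bar>c\<bar> * norm2 (poly p)"
  by (simp add: norm2_def power_mult_distrib real_sqrt_mult)

lemma derivative_bound:
  assumes r: "r \<ge> 3" and k: "k = r - 2 \<or> k = r - 1" and f: "f \<in> L2r r"
  shows "norm_inf (derivI k f) \<le> ereal (norm2 (poly ((pderiv ^^ r) (u0 r k))) * norm2 f
    + norm2 (poly (u0 r k)) * norm2 (derivI r f))"
proof -
  obtain a b where "kernel_pair r a b" using kernel_pair_exists[OF r] .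
  then interpret kernel_pair r a b .
  have sgn: "\<bar>(-1 :: real) ^ (r - 2)\<bar> = 1" by simp
  show ?thesis
  proof (rule norm_inf_derivative_le[OF f])
    show "k < r" using r k by auto
    fix x assume x: "x \<in> II"
    show "\<bar>derivI k f x\<bar> \<le> norm2 (poly ((pderiv ^^ r) (u0 r k))) * norm2 f + norm2 (poly (u0 r k)) * norm2 (derivI r f)"
      using k
    proof
      assume k: "k = r - 1"
      have "u0 r k = smult ((-1) ^ (r - 2)) b"
        using u0_eqI[OF _ u0_conditions_b] r k by simp
      then show ?thesis
        using derivative_bound_1[OF f x] k by (simp only: higher_pderiv_smult norm2_smult sgn mult_1)
    next
      assume k: "k = r - 2"
      have "u0 r k = smult ((-1) ^ (r - 2)) (a - b)"
        using u0_eqI[OF _ u0_conditions_a] r k by simp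
      then show ?thesis
        using derivative_bound_2[OF f x] k by (simp only: higher_pderiv_smult norm2_smult sgn mult_1)
    qed
  qed
qed

section \<open>Sharpness\<close>

lemma higher_poly_antiderivative:
  fixes p :: "real poly"
  shows "\<exists>P. (pderiv ^^ n) P = p"
proof (induction n arbitrary: p)
  case (Suc n)
  obtain Q where "pderiv Q = p" by (rule poly_antiderivative)
  moreover obtain P where "(pderiv ^^ n) P = Q" using Suc.IH by blast
  ultimately show ?case by auto
qed simp

text \<open>Let \<open>q\<close> be the derivative of \<open>u\<close> of order \<open>r\<close>,
  and \<open>F = \<Phi> + N q\<close> with \<open>\<Phi>\<close> orthogonal to \<open>q\<close>.
  With \<open>U\<close>, \<open>Q\<close>, \<open>T\<close> the norms of \<open>u\<close>,
  \<open>q\<close>, \<open>\<Phi>\<close>, the derivative of order \<open>k\<close> at -1 is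
  \<open>U + N Q^2\<close>, while \<open>Q\<close> times the norm of \<open>F\<close> is the square
  root of \<open>Q^2 T^2 + N^2 Q^4\<close>, which exceeds \<open>N Q^2\<close> by at most
  \<open>T^2 / (2 N)\<close>.\<close>

lemma extremal_polynomials:
  assumes u: "u0_conditions r k u" and k: "1 \<le> k" "k < r" and e: "e > 0"
  obtains F where "norm2 (derivI r (poly F)) \<le> 1"
    "norm2 (poly u) - e \<le> derivI k (poly F) (-1) - norm2 (poly ((pderiv ^^ r) u)) * norm2 (poly F)"
proof -
  define ip where "ip = (\<lambda>p q. integral II (\<lambda>t. poly p t * poly q t))"
  have int: "(\<lambda>t. poly p t * poly q t) integrable_on II" for p q :: "real poly"
    by (intro integrable_continuous_real continuous_intros)
  have ip_add: "ip p (q + q') = ip p q + ip p q'" for p q q'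
    unfolding ip_def using Henstock_Kurzweil_Integration.integral_add[OF int int] by (simp add: algebra_simps)
  have ip_smult: "ip p (smult c q) = c * ip p q" for p q c
    unfolding ip_def using integral_mult_right[of II c "\<lambda>t. poly p t * poly q t"] by (simp add: algebra_simps)
  have ip_commute: "ip p q = ip q p" for p q by (simp add: ip_def mult.commute)
  have ip_norm: "ip p p = (norm2 (poly p))\<^sup>2" for p
    unfolding norm2_sq_integral[OF L2_poly] ip_def by (simp add: power2_eq_square)
  have ip_CS: "\<bar>ip p q\<bar> \<le> norm2 (poly p) * norm2 (poly q)" for p q
  proof -
    have "ip p q = (LINT t|lebesgue_on II. poly p t * poly q t)"
      unfolding ip_def by (rule lebesgue_integral_eq_integral[symmetric, OF L2_mult_integrable[OF L2_poly L2_poly]]) simp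
    then show ?thesis using L2_Cauchy_Schwarz[OF L2_poly L2_poly, of p q] by simp
  qed
  define q where "q = (pderiv ^^ r) u"
  \<comment> \<open>\<open>u\<close> has degree below \<open>2 r\<close>, so adding multiples of
    \<open>q\<close> leaves derivatives of order \<open>r\<close> unchanged.\<close>
  have Dq: "(pderiv ^^ r) q = 0"
  proof -
    have "degree u < r + r" using u k unfolding u0_conditions_def by auto
    from higher_pderiv_low_degree[OF this] show ?thesis unfolding q_def by (simp add: funpow_add)
  qed
  \<comment> \<open>At 1 all boundary terms vanish; at -1 only the one of index
    \<open>r - k - 1\<close> remains, which carries the derivative of order
    \<open>k\<close>.\<close>
  have repr: "poly ((pderiv ^^ k) F) (-1) = - ((-1) ^ r) * ip u ((pderiv ^^ r) F) + ip q F" for F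
  proof -
    have "((\<lambda>t. poly u t * derivI r (poly F) t - (-1) ^ r * poly ((pderiv ^^ r) u) t * poly F t) has_integral
        boundary_form r u (poly F) 1 - boundary_form r u (poly F) (-1)) II"
      by (rule integration_by_parts[OF poly_in_L2r]) auto
    then have "((\<lambda>t. poly u t * poly ((pderiv ^^ r) F) t - (-1) ^ r * (poly q t * poly F t)) has_integral
        boundary_form r u (poly F) 1 - boundary_form r u (poly F) (-1)) II"
      by (rule has_integral_eq[rotated]) (simp add: derivI_poly(1) q_def)
    moreover have "boundary_form r u (poly F) 1 = 0"
      using u by (intro boundary_form_zero) (simp add: u0_conditions_def)
    moreover have "boundary_form r u (poly F) (-1) = (-1) ^ (r - k - 1) * (-1) ^ (k - 1) * derivI (r - 1 - (r - k - 1)) (poly F) (-1)"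
      using u k by (intro boundary_form_single) (auto simp: u0_conditions_def)
    moreover have "r - 1 - (r - k - 1) = k" using k by simp
    moreover have "(-1 :: real) ^ (r - k - 1) * (-1) ^ (k - 1) = (-1) ^ r"
    proof -
      \<comment> \<open>The exponents add up to \<open>r - 2\<close>, which has the parity of
        \<open>r\<close>.\<close>
      have "r = (r - k - 1) + (k - 1) + 2" using k by simp
      then show ?thesis by (metis power_add power2_eq_square mult_minus1_right minus_minus mult.right_neutral)
    qed
    ultimately have "((\<lambda>t. poly u t * poly ((pderiv ^^ r) F) t - (-1) ^ r * (poly q t * poly F t)) has_integral
        - ((-1) ^ r * poly ((pderiv ^^ k) F) (-1))) II"
      by (simp add: derivI_poly(1))
    moreover have "((\<lambda>t. poly u t * poly ((pderiv ^^ r) F) t - (-1) ^ r * (poly q t * poly F t)) has_integral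
        ip u ((pderiv ^^ r) F) - (-1) ^ r * ip q F) II"
      unfolding ip_def by (intro has_integral_diff has_integral_mult_right integrable_integral int)
    ultimately have eq: "- ((-1) ^ r * poly ((pderiv ^^ k) F) (-1)) = ip u ((pderiv ^^ r) F) - (-1) ^ r * ip q F"
      by (rule has_integral_unique)
    have sq: "(-1 :: real) ^ r * (-1) ^ r = 1" by (simp flip: power_add)
    show ?thesis
      using arg_cong[OF eq, of "\<lambda>y. - ((-1) ^ r) * y"] sq by (simp add: right_diff_distrib mult.assoc[symmetric])
  qed
  define U where "U = norm2 (poly u)"
  \<comment> \<open>The factor normalizes \<open>u\<close>, with the sign for which the inner
    product with \<open>u\<close> contributes \<open>U\<close> to the representation. For
    \<open>U = 0\<close> the quotient is 0 and the later identities still hold.\<close>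
  obtain \<Phi>0 where \<Phi>0: "(pderiv ^^ r) \<Phi>0 = smult (- ((-1) ^ r) / U) u" using higher_poly_antiderivative by blast
  \<comment> \<open>Subtracting \<open>c\<close> times \<open>q\<close> is orthogonal projection. If
    \<open>ip q q = 0\<close>, Cauchy-Schwarz shows that \<open>\<Phi>0\<close> is already
    orthogonal to \<open>q\<close>.\<close>
  define c where "c = ip q \<Phi>0 / ip q q"
  define \<Phi> where "\<Phi> = \<Phi>0 + smult (- c) q"
  have orth: "ip q \<Phi> = 0"
  proof (cases "ip q q = 0")
    case True
    then have "norm2 (poly q) = 0" by (simp add: ip_norm)
    then have "ip q \<Phi>0 = 0" using ip_CS[of q \<Phi>0] by simp
    then show ?thesis by (simp only: \<Phi>_def ip_add ip_smult True)
  next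
    case False
    then show ?thesis by (simp only: \<Phi>_def ip_add ip_smult c_def) simp
  qed
  \<comment> \<open>Large enough for \<open>T^2 / (2 N) \<le> e\<close>; the added 1 keeps
    \<open>N\<close> positive when \<open>\<Phi>\<close> has norm 0.\<close>
  define N where "N = ((norm2 (poly \<Phi>))\<^sup>2 + 1) / (2 * e)"
  have N: "N > 0" using e by (simp add: N_def add_nonneg_pos)
  define F where "F = \<Phi> + smult N q"
  have DF: "(pderiv ^^ r) F = smult (- ((-1) ^ r) / U) u"
    by (simp only: F_def \<Phi>_def higher_pderiv_add higher_pderiv_smult Dq \<Phi>0) simp
  have "norm2 (derivI r (poly F)) = norm2 (poly ((pderiv ^^ r) F))"
    by (rule norm2_cong) (simp add: derivI_poly(1))
  also have "\<dots> = \<bar>- ((-1) ^ r) / U\<bar> * U"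
    unfolding DF norm2_smult U_def ..
  also have "\<dots> \<le> 1"
    by (simp add: U_def abs_divide norm2_nonneg)
  finally have "norm2 (derivI r (poly F)) \<le> 1" .
  moreover have "norm2 (poly u) - e \<le> derivI k (poly F) (-1) - norm2 (poly ((pderiv ^^ r) u)) * norm2 (poly F)"
  proof -
    define Q where "Q = norm2 (poly q)"
    define T where "T = norm2 (poly \<Phi>)"
    have qF: "ip q F = N * Q\<^sup>2"
      unfolding F_def ip_add ip_smult orth ip_norm Q_def by simp
    have "derivI k (poly F) (-1) = poly ((pderiv ^^ k) F) (-1)"
      by (rule derivI_poly(1)) simp
    also have "\<dots> = - ((-1) ^ r) * (- ((-1) ^ r) / U * U\<^sup>2) + N * Q\<^sup>2"
      unfolding repr DF ip_smult ip_norm qF U_def ..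
    also have "- ((-1) ^ r) * (- ((-1) ^ r) / U * U\<^sup>2) = U"
      by (simp add: power2_eq_square flip: power_add)
    finally have val: "derivI k (poly F) (-1) = U + N * Q\<^sup>2" .
    have "(norm2 (poly F))\<^sup>2 = ip F F" by (simp add: ip_norm)
    also have "\<dots> = ip \<Phi> \<Phi> + N * ip \<Phi> q + N * (ip q \<Phi> + N * ip q q)"
      unfolding F_def
      by (simp only: ip_add ip_smult ip_commute[of "\<Phi> + smult N q"])
    also have "\<dots> = T\<^sup>2 + N\<^sup>2 * Q\<^sup>2"
      using orth ip_commute[of \<Phi> q] by (simp add: ip_norm T_def Q_def power2_eq_square)
    finally have nF: "(norm2 (poly F))\<^sup>2 = T\<^sup>2 + N\<^sup>2 * Q\<^sup>2" .
    have "(Q * norm2 (poly F))\<^sup>2 = Q\<^sup>2 * T\<^sup>2 + N\<^sup>2 * Q\<^sup>2 * Q\<^sup>2"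
      by (simp add: power_mult_distrib nF algebra_simps)
    \<comment> \<open>The right-hand side is larger by exactly the square of
      \<open>T^2 / (2 N)\<close>.\<close>
    also have "\<dots> \<le> (N * Q\<^sup>2 + T\<^sup>2 / (2 * N))\<^sup>2"
    proof -
      have "(N * Q\<^sup>2 + T\<^sup>2 / (2 * N))\<^sup>2 = Q\<^sup>2 * T\<^sup>2 + N\<^sup>2 * Q\<^sup>2 * Q\<^sup>2 + (T\<^sup>2 / (2 * N))\<^sup>2"
        using N by (simp add: power2_eq_square field_simps)
      then show ?thesis by simp
    qed
    finally have "Q * norm2 (poly F) \<le> N * Q\<^sup>2 + T\<^sup>2 / (2 * N)"
      by (rule power2_le_imp_le) (use N in simp)
    moreover have "T\<^sup>2 / (2 * N) \<le> e"
    proof -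
      have "e * (2 * N) = T\<^sup>2 + 1" using e by (simp add: N_def T_def)
      then show ?thesis using N by (simp add: pos_divide_le_eq)
    qed
    ultimately show ?thesis using val by (simp add: U_def Q_def q_def)
  qed
  ultimately show thesis by (rule that)
qed

theorem theorem10:
  fixes r k :: nat
  assumes "r \<ge> 3" and "k = r - 2 \<or> k = r - 1"
  shows "(\<forall>f \<in> L2r r.
            norm_inf (derivI k f)
              \<le> ereal (norm2 (poly ((pderiv ^^ r) (u0 r k))) * norm2 f
                       + norm2 (poly (u0 r k)) * norm2 (derivI r f))) \<and>
         ereal (norm2 (poly (u0 r k)))
           = (SUP f \<in> {f \<in> L2r r. norm2 (derivI r f) \<le> 1}.
                norm_inf (derivI k f)
                  - ereal (norm2 (poly ((pderiv ^^ r) (u0 r k))) * norm2 f))"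
proof (intro conjI ballI)
  let ?u = "u0 r k"
  let ?A = "norm2 (poly ((pderiv ^^ r) ?u))" and ?B = "norm2 (poly ?u)"
  show bound: "norm_inf (derivI k f) \<le> ereal (?A * norm2 f + ?B * norm2 (derivI r f))" if "f \<in> L2r r" for f
    using derivative_bound[OF assms that] .
  show "ereal ?B = (SUP f \<in> {f \<in> L2r r. norm2 (derivI r f) \<le> 1}. norm_inf (derivI k f) - ereal (?A * norm2 f))"
    (is "_ = ?S")
  proof (rule antisym)
    show "?S \<le> ereal ?B"
    proof (rule SUP_least)
      fix f assume "f \<in> {f \<in> L2r r. norm2 (derivI r f) \<le> 1}"
      then have f: "f \<in> L2r r" "norm2 (derivI r f) \<le> 1" by auto
      have "?B * norm2 (derivI r f) \<le> ?B" using f(2) norm2_nonneg mult_left_le by blast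
      then have "norm_inf (derivI k f) \<le> ereal (?A * norm2 f + ?B)"
        using bound[OF f(1)] by (meson add_left_mono ereal_less_eq(3) order_trans)
      then show "norm_inf (derivI k f) - ereal (?A * norm2 f) \<le> ereal ?B"
        by (cases "norm_inf (derivI k f)") auto
    qed
    have k: "1 \<le> k" "k < r" using assms by auto
    have u: "u0_conditions r k ?u"
      using theI'[OF u0_conditions_ex1[of r k]] assms by (simp add: u0_def)
    show "ereal ?B \<le> ?S"
    proof (rule ereal_le_epsilon2)
      \<comment> \<open>Every \<open>e\<close> receives its own polynomial, and the essential
        supremum of its derivative is bounded below by the value at the left end point.\<close>
      fix e :: real assume "0 < e"
      then obtain F where F: "norm2 (derivI r (poly F)) \<le> 1"
        "?B - e \<le> derivI k (poly F) (-1) - ?A * norm2 (poly F)"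
        using extremal_polynomials[OF u k] by blast
      have "ereal \<bar>derivI k (poly F) (-1)\<bar> \<le> norm_inf (derivI k (poly F))"
        by (rule norm_inf_ge_left[OF L2r_continuous_on[OF poly_in_L2r k(2)]])
      then have "ereal (?B - e) \<le> norm_inf (derivI k (poly F)) - ereal (?A * norm2 (poly F))"
        using F(2) by (cases "norm_inf (derivI k (poly F))") auto
      also have "\<dots> \<le> ?S"
        using F(1) poly_in_L2r by (intro SUP_upper) auto
      finally show "ereal ?B \<le> ?S + ereal e"
        by (cases ?S) auto
    qed
  qed
qed

end
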